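(* Let $X$ be a connected graph, $W$ a complex-weighted adjacency matrix of $X$, and $H=\sum_\lambda\lambda E_\lambda$ the spectral decomposition of the Hermitian adjacency matrix of $X$ associated with $W$. Let $a,b$ be vertices. The quantum walk with respect to $(X,W)$ admits $ab$-PGST if and only if the following hold: (i) $a$ and $b$ are strongly cospectral relative to $H$, and there is a unimodular $\gamma\in\mathbb{C}$ such that $\Lambda_a=\Lambda_{ab}^+\cup\Lambda_{ab}^-$, where these are the plus and minus sets relative to $\gamma$; (ii) for every family of integers $\{\ell_\lambda:\lambda\in\Lambda_a\}$ with $\sum_{\lambda\in\Lambda_a}\ell_\lambda\arccos\lambda\equiv 0\pmod{2\pi}$, we have $\sum_{\lambda\in\Lambda_{ab}^-}\ell_\lambda\equiv0\pmod 2$.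
   Context: $W_{uv}\neq0$ iff $u\sim v$. Arcs are ordered pairs $(u,v)$ with $\{u,v\}\in E(X)$; $R$ swaps $(u,v)$ and $(v,u)$; $N_t$ is the vertex-by-arc matrix with $(N_t)_{u,(a,b)}=w_{ab}/\sqrt{(WW^* )_{aa}}$ if $u=a$, else $0$. The walk with respect to $(X,W)$ has transition matrix $U=R(2N_t^*N_t-I)$. The associated Hermitian adjacency matrix is $H=(I\circ WW^* )^{-1/2}(W\circ W^* )(I\circ WW^* )^{-1/2}=N_tRN_t^*$ (its eigenvalues lie in $[-1,1]$). Pretty good state transfer from state $x$ to state $y$: there is unimodular $\gamma'$ such that for every $\epsilon>0$ some $t\in\mathbb{Z}$ has $\|U^tx-\gamma' y\|<\epsilon$; $ab$-PGST means PGST from $N_t^*e_a$ to $N_t^*e_b$. Vertices $a,b$ are strongly cospectral relative to $H$ if for every eigenprojection $E_\lambda$ there is a unimodular $\mu_\lambda$ with $E_\lambda e_a=\mu_\lambda E_\lambda e_b$. $\Lambda_a=\{\lambda:E_\lambda e_a\neq0\}$. For unimodular $\gamma$: $\Lambda_{ab}^+=\{\lambda:E_\lambda e_a=\gamma E_\lambda e_b\neq0\}$, $\Lambda_{ab}^-=\{\lambda:E_\lambda e_a=-\gamma E_\lambda e_b\neq0\}$. *)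

theory Defs
  imports "HOL-Analysis.Analysis" "HOL-Library.Real_Mod"
begin

text \<open>
  The vertex set of a graph is a finite type, and the graph is its adjacency relation.
\<close>

definition simple_graph :: "('v \<Rightarrow> 'v \<Rightarrow> bool) \<Rightarrow> bool" where
  "simple_graph adj \<longleftrightarrow> symp adj \<and> irreflp adj"

definition connected_graph :: "('v \<Rightarrow> 'v \<Rightarrow> bool) \<Rightarrow> bool" where
  "connected_graph adj \<longleftrightarrow> simple_graph adj \<and> (\<forall>u v. adj\<^sup>*\<^sup>* u v)"

definition arcs :: "('v \<Rightarrow> 'v \<Rightarrow> bool) \<Rightarrow> ('v \<times> 'v) set" where
  "arcs adj = {(u, v). adj u v}"

text \<open>
  The set of arcs depends on the graph and so is not itself a type. Arc-indexed vectors and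
  matrices are indexed by a finite type together with a bijection from it onto the set of arcs.
\<close>

definition arc_labelling :: "('v \<Rightarrow> 'v \<Rightarrow> bool) \<Rightarrow> ('e \<Rightarrow> 'v \<times> 'v) \<Rightarrow> bool" where
  "arc_labelling adj ar \<longleftrightarrow> bij_betw ar UNIV (arcs adj)"

definition weighted_adjacency_matrix ::
    "('v::finite \<Rightarrow> 'v \<Rightarrow> bool) \<Rightarrow> complex^'v^'v \<Rightarrow> bool" where
  "weighted_adjacency_matrix adj W \<longleftrightarrow> (\<forall>u v. W $ u $ v \<noteq> 0 \<longleftrightarrow> adj u v)"

definition conj_transpose :: "complex^'n^'m \<Rightarrow> complex^'m^'n" where
  "conj_transpose A = (\<chi> i j. cnj (A $ j $ i))"

primrec mat_pow :: "'a::semiring_1^'n^'n \<Rightarrow> nat \<Rightarrow> 'a^'n^'n" where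
  "mat_pow A 0 = mat 1"
| "mat_pow A (Suc n) = A ** mat_pow A n"

definition mat_int_pow :: "'a::semiring_1^'n^'n \<Rightarrow> int \<Rightarrow> 'a^'n^'n" where
  "mat_int_pow A t =
     (if t \<ge> 0 then mat_pow A (nat t) else mat_pow (matrix_inv A) (nat (- t)))"

definition arc_reversal :: "('e::finite \<Rightarrow> 'v \<times> 'v) \<Rightarrow> complex^'e^'e" where
  "arc_reversal ar = (\<chi> e f. if ar e = prod.swap (ar f) then 1 else 0)"

definition tail_matrix ::
    "('e::finite \<Rightarrow> 'v::finite \<times> 'v) \<Rightarrow> complex^'v^'v \<Rightarrow> complex^'e^'v" where
  "tail_matrix ar W =
     (\<chi> u e. case ar e of (a, b) \<Rightarrow>
        if u = a then W $ a $ b / csqrt ((W ** conj_transpose W) $ a $ a) else 0)"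

definition transition_matrix ::
    "('e::finite \<Rightarrow> 'v::finite \<times> 'v) \<Rightarrow> complex^'v^'v \<Rightarrow> complex^'e^'e" where
  "transition_matrix ar W =
     arc_reversal ar **
       (2 *\<^sub>R (conj_transpose (tail_matrix ar W) ** tail_matrix ar W) - mat 1)"

definition inv_sqrt_diag :: "complex^'v^'v \<Rightarrow> complex^'v^'v" where
  "inv_sqrt_diag M = (\<chi> u v. if u = v then 1 / csqrt (M $ u $ u) else 0)"

definition hermitian_adjacency :: "complex^'v^'v \<Rightarrow> complex^'v^'v" where
  "hermitian_adjacency W =
     inv_sqrt_diag (W ** conj_transpose W)
       ** (\<chi> u v. W $ u $ v * conj_transpose W $ u $ v)
       ** inv_sqrt_diag (W ** conj_transpose W)"

lemma hermitian_adjacency_eq_tail_matrix: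
  assumes ar: "arc_labelling adj ar" and W: "weighted_adjacency_matrix adj W"
    and c: "connected_graph adj"
  shows "hermitian_adjacency W =
    tail_matrix ar W ** arc_reversal ar ** conj_transpose (tail_matrix ar W)"
proof -
  define d where "d = (\<lambda>u. csqrt ((W ** conj_transpose W) $ u $ u))"
  have Wd: "(W ** conj_transpose W) $ u $ u = of_real (\<Sum>v\<in>UNIV. (cmod (W$u$v))\<^sup>2)" for u
    by (simp add: matrix_matrix_mult_def conj_transpose_def complex_mult_cnj cmod_power2)
  have dr: "cnj (d u) = d u" for u proof -
    have "csqrt (of_real r) = of_real (sqrt r)" if "r \<ge> 0" for r using that by (simp add: csqrt_of_real_nonneg)
    then show ?thesis unfolding d_def Wd by (metis complex_cnj_complex_of_real sum_nonneg zero_le_power2)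
  qed
  have sy: "adj u v \<Longrightarrow> adj v u" for u v using c by (auto simp: connected_graph_def simple_graph_def symp_def)
  have inj: "inj ar" and rng: "range ar = {(u,v). adj u v}" using ar
    by (auto simp: arc_labelling_def bij_betw_def arcs_def)
  have L: "hermitian_adjacency W $ u $ v = W$u$v * cnj (W$v$u) / (d u * d v)" for u v
    unfolding hermitian_adjacency_def d_def[symmetric]
    by (simp add: matrix_matrix_mult_def inv_sqrt_diag_def conj_transpose_def d_def if_distrib if_distribR cong: if_cong)
  have R: "(tail_matrix ar W ** arc_reversal ar ** conj_transpose (tail_matrix ar W)) $ u $ v = W$u$v * cnj (W$v$u) / (d u * d v)" for u v
  proof -
    let ?N = "tail_matrix ar W"
    have N: "?N $ u $ e = (if u = fst (ar e) then W $ u $ snd (ar e) / d u else 0)" for u e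
      by (auto simp: tail_matrix_def d_def split: prod.split)
    have "(?N ** arc_reversal ar ** conj_transpose ?N) $ u $ v
       = (\<Sum>f\<in>UNIV. \<Sum>e\<in>UNIV. ?N $ u $ e * (if ar e = prod.swap (ar f) then 1 else 0) * cnj (?N $ v $ f))"
      by (simp add: matrix_matrix_mult_def arc_reversal_def conj_transpose_def sum_distrib_right)
    also have "\<dots> = (\<Sum>f\<in>UNIV. \<Sum>e\<in>UNIV. if ar f = (v,u) \<and> ar e = (u,v) then W$u$v * cnj (W$v$u) / (d u * d v) else 0)"
      by (intro sum.cong refl) (auto simp: N dr prod_eq_iff)
    also have "\<dots> = W$u$v * cnj (W$v$u) / (d u * d v)"
    proof (cases "adj u v")
      case True
      then obtain e f where e: "ar e = (u,v)" and f: "ar f = (v,u)" using rng sy 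
        by (metis (mono_tags, lifting) case_prodI mem_Collect_eq rangeE)
      have "ar x = (u,v) \<longleftrightarrow> x = e" "ar x = (v,u) \<longleftrightarrow> x = f" for x using e f inj by (metis injD)+
      then have "(if ar x = (v,u) \<and> ar y = (u,v) then k else 0) = (if x = f then (if y = e then k else 0) else (0::complex))" for x y k by auto
      then show ?thesis by (simp add: sum.delta if_distrib[where f="\<lambda>g. sum g UNIV"]) (simp add: sum.If_cases)
    next
      case False
      then have "ar e \<noteq> (u,v)" for e using rng by (metis (mono_tags, lifting) case_prodD mem_Collect_eq rangeI)
      moreover have "W $ u $ v = 0" using False W by (auto simp: weighted_adjacency_matrix_def)
      ultimately show ?thesis by simp
    qed
    finally show ?thesis .
  qed
  show ?thesis by (simp add: vec_eq_iff L R)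
qed

definition pgst :: "complex^'e^'e \<Rightarrow> complex^'e \<Rightarrow> complex^'e \<Rightarrow> bool" where
  "pgst U x y \<longleftrightarrow>
     (\<exists>\<gamma>. cmod \<gamma> = 1 \<and>
        (\<forall>\<epsilon>>0. \<exists>t::int. norm (mat_int_pow U t *v x - \<gamma> *s y) < \<epsilon>))"

definition vertex_pgst ::
    "('e::finite \<Rightarrow> 'v::finite \<times> 'v) \<Rightarrow> complex^'v^'v \<Rightarrow> 'v \<Rightarrow> 'v \<Rightarrow> bool" where
  "vertex_pgst ar W a b \<longleftrightarrow>
     pgst (transition_matrix ar W)
       (conj_transpose (tail_matrix ar W) *v axis a 1)
       (conj_transpose (tail_matrix ar W) *v axis b 1)"

text \<open>
  The notions below are meant for Hermitian matrices, whose eigenvalues are all real.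
\<close>

definition eigenspace :: "complex^'v^'v \<Rightarrow> real \<Rightarrow> (complex^'v) set" where
  "eigenspace H \<theta> = {x. H *v x = complex_of_real \<theta> *s x}"

definition eigenvalues :: "complex^'v^'v \<Rightarrow> real set" where
  "eigenvalues H = {\<theta>. \<exists>x. x \<noteq> 0 \<and> x \<in> eigenspace H \<theta>}"

text \<open>The orthogonal projection onto the eigenspace.\<close>

definition eigenprojection :: "complex^'v^'v \<Rightarrow> real \<Rightarrow> complex^'v^'v" where
  "eigenprojection H \<theta> =
     (THE P. conj_transpose P = P \<and> P ** P = P \<and> range ((*v) P) = eigenspace H \<theta>)"

definition strongly_cospectral :: "complex^'v^'v \<Rightarrow> 'v \<Rightarrow> 'v \<Rightarrow> bool" where
  "strongly_cospectral H a b \<longleftrightarrow>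
     (\<forall>\<theta>\<in>eigenvalues H. \<exists>\<mu>. cmod \<mu> = 1 \<and>
        eigenprojection H \<theta> *v axis a 1 = \<mu> *s (eigenprojection H \<theta> *v axis b 1))"

definition eigenvalue_support :: "complex^'v^'v \<Rightarrow> 'v \<Rightarrow> real set" where
  "eigenvalue_support H a = {\<theta>\<in>eigenvalues H. eigenprojection H \<theta> *v axis a 1 \<noteq> 0}"

definition plus_set :: "complex^'v^'v \<Rightarrow> complex \<Rightarrow> 'v \<Rightarrow> 'v \<Rightarrow> real set" where
  "plus_set H \<gamma> a b =
     {\<theta>\<in>eigenvalues H.
        eigenprojection H \<theta> *v axis a 1 = \<gamma> *s (eigenprojection H \<theta> *v axis b 1) \<and>
        \<gamma> *s (eigenprojection H \<theta> *v axis b 1) \<noteq> 0}"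

definition minus_set :: "complex^'v^'v \<Rightarrow> complex \<Rightarrow> 'v \<Rightarrow> 'v \<Rightarrow> real set" where
  "minus_set H \<gamma> a b =
     {\<theta>\<in>eigenvalues H.
        eigenprojection H \<theta> *v axis a 1 = (- \<gamma>) *s (eigenprojection H \<theta> *v axis b 1) \<and>
        (- \<gamma>) *s (eigenprojection H \<theta> *v axis b 1) \<noteq> 0}"

end

theory Submission
  imports Defs "HOL-Real_Asymp.Real_Asymp"
begin

text \<open>
  Let \<open>N\<close> be the tail matrix, so \<open>N N\<^sup>* = I\<close> and \<open>H = N R N\<^sup>*\<close>. On an eigenvector of \<open>H\<close> with
  eigenvalue \<open>\<theta>\<close> the compressed walk \<open>N U\<^sup>t N\<^sup>*\<close> acts as the Chebyshev multiple \<open>cos (t arccos \<theta>)\<close>.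
  Since \<open>U\<close> is unitary, pretty good state transfer from \<open>N\<^sup>* e\<^sub>a\<close> to \<open>N\<^sup>* e\<^sub>b\<close> means that
  \<open>\<Sum>\<^sub>\<theta> cos (t arccos \<theta>) E\<^sub>\<theta> e\<^sub>a\<close> comes arbitrarily close to \<open>\<gamma> e\<^sub>b\<close>. As the squared norms of the
  \<open>E\<^sub>\<theta> e\<^sub>a\<close> and of the \<open>E\<^sub>\<theta> e\<^sub>b\<close> both sum to 1, this forces \<open>E\<^sub>\<theta> e\<^sub>a = \<plusminus>\<gamma> E\<^sub>\<theta> e\<^sub>b\<close> and
  \<open>cos (t arccos \<theta>) \<rightarrow> \<plusminus>1\<close> with the same signs. By a Kronecker-type theorem the signs can be
  approximated simultaneously iff they respect all integer relations between the angles
  \<open>arccos \<theta>\<close> modulo \<open>2\<pi>\<close>.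
\<close>

section \<open>Simultaneous approximation of signs\<close>

text \<open>Unless \<open>cos \<phi> = 1\<close>, the partial sums are real parts of geometric sums
  with ratio \<open>cis \<phi> \<noteq> 1\<close>, hence bounded. Averaging over \<open>n\<close>
  therefore isolates the frequencies that vanish modulo \<open>2 * pi\<close>.\<close>

lemma cesaro_mean_cos:
  fixes \<phi> :: real
  shows "(\<lambda>T. (\<Sum>n<T. cos (real n * \<phi>)) / real T)
           \<longlonglongrightarrow> (if cos \<phi> = 1 then 1 else 0)"
proof (cases "cos \<phi> = 1")
  case True
  then obtain k where k: "\<phi> = of_int k * 2 * pi"
    by (auto simp: cos_one_2pi_int)
  have "cos (real n * \<phi>) = 1" for n
    unfolding cos_one_2pi_int k by (rule exI[of _ "int n * k"]) simp
  moreover have "\<forall>\<^sub>F T in sequentially. real T / real T = 1"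
    using eventually_gt_at_top[of 0] by eventually_elim simp
  ultimately show ?thesis
    using True by (auto intro: tendsto_eventually)
next
  case False
  define z where "z = cis \<phi>"
  have z: "z \<noteq> 1"
    using False by (auto simp: z_def complex_eq_iff)
  have bound: "\<bar>\<Sum>n<T. cos (real n * \<phi>)\<bar> \<le> 2 / cmod (z - 1)" for T
  proof -
    have "(\<Sum>n<T. cos (real n * \<phi>)) = Re (\<Sum>n<T. z ^ n)"
      by (simp add: z_def Complex.DeMoivre)
    also have "\<bar>\<dots>\<bar> \<le> cmod (\<Sum>n<T. z ^ n)"
      by (rule abs_Re_le_cmod)
    also have "\<dots> = cmod (z ^ T - 1) / cmod (z - 1)"
      using z by (simp add: geometric_sum norm_divide)
    also have "\<dots> \<le> 2 / cmod (z - 1)"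
      using norm_triangle_ineq4[of "z ^ T" 1]
      by (intro divide_right_mono) (auto simp: z_def norm_power)
    finally show ?thesis .
  qed
  have "(\<lambda>T. (\<Sum>n<T. cos (real n * \<phi>)) / real T) \<longlonglongrightarrow> 0"
  proof (rule Lim_null_comparison)
    show "\<forall>\<^sub>F T in sequentially.
        norm ((\<Sum>n<T. cos (real n * \<phi>)) / real T) \<le> 2 / cmod (z - 1) / real T"
      by (intro always_eventually allI)
        (simp add: bound divide_right_mono del: divide_divide_eq_left)
    show "(\<lambda>T. 2 / cmod (z - 1) / real T) \<longlonglongrightarrow> 0"
      by (intro tendsto_divide_0[OF tendsto_const] filterlim_at_top_imp_at_infinity
          filterlim_real_sequentially)
  qed
  with False show ?thesis by simp
qed

lemma prod_powi_times_cis: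
  fixes s \<theta> :: "'a \<Rightarrow> real" and l :: "'a \<Rightarrow> int"
  assumes "finite A"
  shows "(\<Prod>x\<in>A. (of_real (s x) * cis (\<theta> x)) powi l x) =
    of_real (\<Prod>x\<in>A. s x powi l x) * cis (\<Sum>x\<in>A. of_int (l x) * \<theta> x)"
  using assms
  by (induction A rule: finite_induct)
    (simp_all add: power_int_mult_distrib cis_power_int cis_mult[symmetric])

text \<open>For a sign \<open>s\<close> the inverse of \<open>w = s * cis x\<close> is its
  conjugate, so \<open>2 + 2 * s * cos x = inverse w * (1 + w)^2\<close>. The binomial theorem then
  gives positive coefficients, which the averaging argument relies on.\<close>

lemma fejer_power_expansion:
  fixes s x :: real
  assumes "s = 1 \<or> s = -1"
  shows "of_real ((2 + 2 * s * cos x) ^ k) =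
    (\<Sum>j\<le>2*k. of_nat ((2*k) choose j) * (of_real s * cis x) powi (int j - int k))"
proof -
  define w where "w = of_real s * cis x"
  have w0: "w \<noteq> 0" using assms by (auto simp: w_def)
  have inv: "inverse w = of_real s * cis (- x)"
    using assms by (auto simp: w_def)
  have "of_real (2 + 2 * s * cos x) = inverse w * (1 + w)\<^sup>2"
  proof -
    have "inverse w * (1 + w)\<^sup>2 = inverse w + 2 + w"
      using w0 by (simp add: power2_eq_square field_simps)
    then show ?thesis unfolding inv by (simp add: w_def complex_eq_iff)
  qed
  then have "of_real ((2 + 2 * s * cos x) ^ k) = (inverse w * (1 + w)\<^sup>2) ^ k"
    by (metis of_real_power)
  also have "\<dots> = inverse w ^ k * (w + 1) ^ (2 * k)"
    by (simp add: power_mult_distrib power_mult add.commute)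
  also have "\<dots> = (\<Sum>j\<le>2*k. of_nat ((2*k) choose j) * (w ^ j * inverse w ^ k))"
    by (simp add: binomial_ring sum_distrib_left mult_ac)
  also have "\<dots> = (\<Sum>j\<le>2*k. of_nat ((2*k) choose j) * w powi (int j - int k))"
    using w0 by (simp add: power_int_diff field_simps)
  finally show ?thesis by (simp add: w_def)
qed

text \<open>Each \<open>g\<close> picks one exponent per factor when the product is multiplied out.
  The computation stays complex until the end, because powers of \<open>cis\<close> merge into a
  single \<open>cis\<close> whose real part is the cosine.\<close>

lemma prod_fejer_power_expansion:
  fixes s \<theta> :: "'a \<Rightarrow> real"
  assumes "finite A" and s: "\<And>x. x \<in> A \<Longrightarrow> s x = 1 \<or> s x = -1"
  shows "(\<Prod>x\<in>A. (2 + 2 * s x * cos (real n * \<theta> x)) ^ k) =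
    (\<Sum>g\<in>PiE A (\<lambda>_. {..2*k}).
       real (\<Prod>x\<in>A. (2*k) choose g x) * (\<Prod>x\<in>A. s x powi (int (g x) - int k)) *
       cos (real n * (\<Sum>x\<in>A. of_int (int (g x) - int k) * \<theta> x)))"
  (is "?L = ?R")
proof -
  have "complex_of_real ?L =
      (\<Prod>x\<in>A. \<Sum>j\<le>2*k. of_nat ((2*k) choose j) *
        (of_real (s x) * cis (real n * \<theta> x)) powi (int j - int k))"
    using s by (simp only: of_real_prod fejer_power_expansion cong: prod.cong)
  also have "\<dots> = (\<Sum>g\<in>PiE A (\<lambda>_. {..2*k}). \<Prod>x\<in>A. of_nat ((2*k) choose g x) *
        (of_real (s x) * cis (real n * \<theta> x)) powi (int (g x) - int k))"
    using assms(1) by (subst prod_sum_PiE) simp_all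
  also have "\<dots> = (\<Sum>g\<in>PiE A (\<lambda>_. {..2*k}).
       of_real (real (\<Prod>x\<in>A. (2*k) choose g x) * (\<Prod>x\<in>A. s x powi (int (g x) - int k))) *
       cis (real n * (\<Sum>x\<in>A. of_int (int (g x) - int k) * \<theta> x)))"
    by (intro sum.cong refl)
      (simp add: prod.distrib prod_powi_times_cis[OF assms(1)] sum_distrib_left mult_ac)
  finally have "Re (complex_of_real ?L) = Re \<dots>"
    by (rule arg_cong)
  moreover have "Re (of_real r * cis t) = r * cos t" for r t
    by simp
  ultimately show ?thesis by (simp only: Re_complex_of_real Re_sum)
qed

text \<open>
  The mean over \<open>n\<close> of the product of the
  \<open>((1 + s x * cos (n * \<theta> x)) / 2) ^ k\<close> only sees the frequencies that vanish modulo
  \<open>2 * pi\<close>. By assumption these carry nonnegative coefficients, so the mean is at least the constant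
  term and decays polynomially in \<open>k\<close>. If no \<open>n\<close> satisfied the conclusion, the decay would be
  exponential.
\<close>

lemma kronecker_sign_targets:
  fixes s \<theta> :: "'a \<Rightarrow> real"
  assumes fin: "finite A" and s: "\<And>x. x \<in> A \<Longrightarrow> s x = 1 \<or> s x = -1"
    and rel: "\<And>l :: 'a \<Rightarrow> int.
      cos (\<Sum>x\<in>A. of_int (l x) * \<theta> x) = 1 \<Longrightarrow> (\<Prod>x\<in>A. s x powi l x) = 1"
    and "\<epsilon> > 0"
  shows "\<exists>n::nat. \<forall>x\<in>A. s x * cos (real n * \<theta> x) > 1 - \<epsilon>"
proof (rule ccontr)
  assume "\<not> ?thesis"
  then have neg: "\<exists>x\<in>A. s x * cos (real n * \<theta> x) \<le> 1 - \<epsilon>" for n :: nat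
    by (metis not_le)
  \<comment> \<open>The maximum with \<open>1 / 2\<close> keeps \<open>q\<close> positive for large
    \<open>\<epsilon>\<close>. A factor that misses its target is at most \<open>2 + 2 * (1 -
    \<epsilon>) = 4 * (1 - \<epsilon> / 2) \<le> 4 * q\<close>.\<close>
  define q where "q = max (1 - \<epsilon> / 2) (1 / 2)"
  have q: "0 < q" "q < 1" using \<open>\<epsilon> > 0\<close> by (auto simp: q_def)
  define m where "m = card A"
  define f where "f k n = (\<Prod>x\<in>A. (2 + 2 * s x * cos (real n * \<theta> x)) ^ k)" for k n
  define C where "C k g = real (\<Prod>x\<in>A. (2*k) choose g x)" for k and g :: "'a \<Rightarrow> nat"
  define \<sigma> where "\<sigma> k g = (\<Prod>x\<in>A. s x powi (int (g x) - int k))" for k and g :: "'a \<Rightarrow> nat"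
  define \<phi> where "\<phi> k g = (\<Sum>x\<in>A. of_int (int (g x) - int k) * \<theta> x)" for k and g :: "'a \<Rightarrow> nat"
  define G where "G k = PiE A (\<lambda>_. {..2*k})" for k :: nat
  have finG: "finite (G k)" for k
    unfolding G_def using fin by (intro finite_PiE) auto
  have f_eq: "f k n = (\<Sum>g\<in>G k. C k g * \<sigma> k g * cos (real n * \<phi> k g))" for k n
    unfolding f_def C_def \<sigma>_def \<phi>_def G_def by (rule prod_fejer_power_expansion[OF fin s])

  have f_le: "f k n \<le> (4 ^ k) ^ m * q ^ k" for k n
  proof -
    obtain y where y: "y \<in> A" "s y * cos (real n * \<theta> y) \<le> 1 - \<epsilon>" using neg by blast
    have rng: "0 \<le> 2 + 2 * s x * cos (real n * \<theta> x)" "2 + 2 * s x * cos (real n * \<theta> x) \<le> 4"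
      if "x \<in> A" for x
    proof -
      have "\<bar>s x * cos (real n * \<theta> x)\<bar> \<le> 1"
        using s[OF that] by (auto simp: abs_mult)
      then show "0 \<le> 2 + 2 * s x * cos (real n * \<theta> x)" "2 + 2 * s x * cos (real n * \<theta> x) \<le> 4"
        unfolding mult.assoc by linarith+
    qed
    \<comment> \<open>Only the factor at the violating index \<open>y\<close> supplies the saving
      \<open>q\<close>; all others get the trivial bound 4.\<close>
    have "f k n = (2 + 2 * s y * cos (real n * \<theta> y)) ^ k *
        (\<Prod>x\<in>A - {y}. (2 + 2 * s x * cos (real n * \<theta> x)) ^ k)"
      unfolding f_def using fin y(1) by (simp add: prod.remove)
    also have "\<dots> \<le> (4 * q) ^ k * (\<Prod>x\<in>A - {y}. 4 ^ k)"
      using y rng q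
      by (intro mult_mono power_mono prod_mono conjI prod_nonneg)
        (auto simp: q_def max_def)
    also have "\<dots> = (4 ^ k * (4 ^ k) ^ (m - 1)) * q ^ k"
      using y fin by (simp add: m_def power_mult_distrib)
    also have "\<dots> = (4 ^ k) ^ m * q ^ k"
      using y fin by (metis m_def card_gt_0_iff empty_iff power_minus_mult mult.commute)
    finally show ?thesis .
  qed

  have const_le: "real ((2*k) choose k) ^ m \<le> (4 ^ k) ^ m * q ^ k" for k
  proof -
    let ?L = "\<Sum>g\<in>G k. C k g * \<sigma> k g * (if cos (\<phi> k g) = 1 then 1 else 0)"
    have "(\<lambda>T. \<Sum>g\<in>G k. C k g * \<sigma> k g * ((\<Sum>n<T. cos (real n * \<phi> k g)) / real T)) \<longlonglongrightarrow> ?L"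
      by (intro tendsto_intros cesaro_mean_cos)
    moreover have "(\<Sum>g\<in>G k. C k g * \<sigma> k g * ((\<Sum>n<T. cos (real n * \<phi> k g)) / real T)) =
        (\<Sum>n<T. f k n) / real T" for T
      unfolding f_eq by (subst sum.swap) (simp add: sum_distrib_left sum_divide_distrib)
    ultimately have lim: "(\<lambda>T. (\<Sum>n<T. f k n) / real T) \<longlonglongrightarrow> ?L"
      by simp
    have "?L \<le> (4 ^ k) ^ m * q ^ k"
    proof (rule LIMSEQ_le_const2[OF lim], intro exI[of _ 1] allI impI)
      fix T :: nat assume "T \<ge> 1"
      moreover have "(\<Sum>n<T. f k n) \<le> real T * ((4 ^ k) ^ m * q ^ k)"
        using sum_bounded_above[of "{..<T}" "f k" "(4 ^ k) ^ m * q ^ k"] f_le by simp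
      ultimately show "(\<Sum>n<T. f k n) / real T \<le> (4 ^ k) ^ m * q ^ k"
        by (simp add: field_simps)
    qed
    moreover have "real ((2*k) choose k) ^ m \<le> ?L"
    proof -
      \<comment> \<open>Taking \<open>k\<close> in every factor makes all exponents zero. This is
        the constant term, with one central binomial coefficient per factor.\<close>
      define g\<^sub>0 where "g\<^sub>0 = restrict (\<lambda>_. k) A"
      have mem: "g\<^sub>0 \<in> G k" by (auto simp: g\<^sub>0_def G_def)
      have "\<phi> k g\<^sub>0 = 0" "\<sigma> k g\<^sub>0 = 1" "C k g\<^sub>0 = real ((2*k) choose k) ^ m"
        by (simp_all add: \<phi>_def \<sigma>_def C_def g\<^sub>0_def m_def cong: sum.cong prod.cong)
      then have "real ((2*k) choose k) ^ m =
          C k g\<^sub>0 * \<sigma> k g\<^sub>0 * (if cos (\<phi> k g\<^sub>0) = 1 then 1 else 0)"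
        by simp
      also have "\<dots> \<le> ?L"
      proof (rule member_le_sum[OF mem _ finG])
        fix g assume "g \<in> G k - {g\<^sub>0}"
        have "cos (\<phi> k g) = 1 \<Longrightarrow> \<sigma> k g = 1"
          unfolding \<phi>_def \<sigma>_def by (rule rel)
        then show "0 \<le> C k g * \<sigma> k g * (if cos (\<phi> k g) = 1 then 1 else 0)"
          by (simp add: C_def prod_nonneg)
      qed
      finally show ?thesis .
    qed
    ultimately show ?thesis by linarith
  qed

  \<comment> \<open>The central binomial coefficient is at least \<open>4 ^ k / (2 * k)\<close>.
    Cancelling \<open>(4 ^ k) ^ m\<close> leaves a polynomial in \<open>k\<close> against the
    decaying \<open>q ^ k\<close>.\<close>
  have lower: "1 \<le> (2 * real k) ^ m * q ^ k" if "k > 0" for k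
  proof -
    have "(4 ^ k / (2 * real k)) ^ m \<le> real ((2*k) choose k) ^ m"
      using central_binomial_lower_bound[OF that] by (intro power_mono) auto
    also note const_le[of k]
    finally have "(4 ^ k) ^ m * 1 \<le> (4 ^ k) ^ m * ((2 * real k) ^ m * q ^ k)"
      using that by (simp add: power_divide field_simps)
    then show ?thesis by (subst (asm) mult_le_cancel_left_pos) auto
  qed
  have "(\<lambda>k. (2 * real k) ^ m * q ^ k) \<longlonglongrightarrow> 0"
    using q by real_asymp
  then have "\<forall>\<^sub>F k in sequentially. (2 * real k) ^ m * q ^ k < 1"
    by (rule order_tendstoD) simp
  then have "\<forall>\<^sub>F k in sequentially. (2 * real k) ^ m * q ^ k < 1 \<and> k > 0"
    using eventually_gt_at_top[of 0] by (rule eventually_conj)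
  then obtain k where "(2 * real k) ^ m * q ^ k < 1" "k > 0"
    using eventually_happens'[OF sequentially_bot] by blast
  with lower show False by (meson not_le)
qed

section \<open>Spectral decomposition of Hermitian matrices\<close>

lemma inner_eq_Re_sum:
  fixes x y :: "complex^'n"
  shows "x \<bullet> y = Re (\<Sum>i\<in>UNIV. x $ i * cnj (y $ i))"
  by (simp add: inner_vec_def inner_complex_def)

text \<open>The adjoint identity holds for the Hermitian product, hence for its real part. This lets
  the orthogonality arguments run on the real inner product alone.\<close>

lemma inner_matrix_vector_mult:
  fixes A :: "complex^'n^'m"
  shows "x \<bullet> (A *v y) = (conj_transpose A *v x) \<bullet> y"
proof -
  have "(\<Sum>i\<in>UNIV. x $ i * cnj ((A *v y) $ i)) =
      (\<Sum>j\<in>UNIV. (conj_transpose A *v x) $ j * cnj (y $ j))"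
    by (simp add: matrix_vector_mult_def conj_transpose_def sum_distrib_left sum_distrib_right)
      (subst sum.swap, simp add: mult_ac)
  then show ?thesis by (simp only: inner_eq_Re_sum)
qed

lemma inner_vector_scalar_mult:
  fixes x y :: "complex^'n"
  shows "x \<bullet> (c *s y) = (cnj c *s x) \<bullet> y"
  by (simp add: inner_eq_Re_sum mult_ac)

lemma norm_vector_scalar_mult:
  fixes x :: "complex^'n"
  shows "norm (c *s x) = cmod c * norm x"
  by (simp add: norm_vec_def norm_mult L2_set_right_distrib)

lemma vector_scalar_mult_of_real:
  fixes x :: "complex^'n"
  shows "complex_of_real r *s x = r *\<^sub>R x"
  by (simp add: vec_eq_iff complex_eq_iff)

lemma conj_transpose_conj_transpose [simp]: "conj_transpose (conj_transpose A) = A"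
  by (simp add: conj_transpose_def vec_eq_iff)

lemma conj_transpose_matrix_mult: "conj_transpose (A ** B) = conj_transpose B ** conj_transpose A"
  by (simp add: conj_transpose_def matrix_matrix_mult_def vec_eq_iff mult.commute)

lemma matrix_vector_mult_scaleR_complex:
  fixes A :: "complex^'n^'m"
  shows "A *v (r *\<^sub>R x) = r *\<^sub>R (A *v x)"
  by (simp add: vector_scalar_mult_of_real[symmetric] vector_scalar_commute)

lemma scaleR_matrix_vector_mult_complex:
  fixes A :: "complex^'n^'m"
  shows "(r *\<^sub>R A) *v x = r *\<^sub>R (A *v x)"
  by (simp add: vec_eq_iff matrix_vector_mult_def scaleR_sum_right)

lemma linear_matrix_vector_mult_complex: "linear ((*v) (A :: complex^'n^'m))"
  by (rule linearI) (simp_all add: matrix_vector_right_distrib matrix_vector_mult_scaleR_complex)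

lemma matrix_eq_inner:
  fixes A B :: "complex^'n^'m"
  assumes "\<And>x y. x \<bullet> (A *v y) = x \<bullet> (B *v y)"
  shows "A = B"
proof -
  have "(A *v y - B *v y) \<bullet> (A *v y - B *v y) = 0" for y
    unfolding inner_diff_right using assms by simp
  then show ?thesis by (simp add: matrix_eq)
qed

text \<open>Each projection fixes the common range, so \<open>P ** Q = Q\<close> and
  \<open>Q ** P = P\<close>; taking the adjoint of one identity gives \<open>P = Q\<close>. This is
  the uniqueness behind the definite description in \<open>eigenprojection\<close>.\<close>

lemma orthogonal_projection_unique:
  fixes P Q :: "complex^'n^'n"
  assumes "conj_transpose P = P" "P ** P = P" "conj_transpose Q = Q" "Q ** Q = Q"
    and "range ((*v) P) = range ((*v) Q)"
  shows "P = Q"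
proof -
  have absorb: "A ** B = B"
    if A: "A ** A = A" and r: "range ((*v) B) \<subseteq> range ((*v) A)" for A B :: "complex^'n^'n"
  proof -
    have "A *v (B *v x) = B *v x" for x
    proof -
      obtain y where "B *v x = A *v y" using r by auto
      then show ?thesis using A by (simp add: matrix_vector_mul_assoc)
    qed
    then show ?thesis by (simp add: matrix_eq matrix_vector_mul_assoc)
  qed
  have "P ** Q = Q" "Q ** P = P" using absorb assms by auto
  then show ?thesis using assms(1,3) conj_transpose_matrix_mult by metis
qed

text \<open>Real orthogonal decomposition supplies the map \<open>p\<close>. It is complex linear
  because \<open>S\<close> is closed under complex scalars and a scalar \<open>c\<close> crosses the
  inner product as \<open>cnj c\<close>.\<close>

lemma orthogonal_projection_exists:
  fixes S :: "(complex^'n) set"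
  assumes S: "subspace S" and S_scalar: "\<And>c x. x \<in> S \<Longrightarrow> c *s x \<in> S"
  shows "\<exists>P. conj_transpose P = P \<and> P ** P = P \<and> range ((*v) P) = S"
proof -
  have "\<exists>y. y \<in> S \<and> (\<forall>w\<in>S. (x - y) \<bullet> w = 0)" for x
    using orthogonal_subspace_decomp_exists[of S x] S
    by (metis add_diff_cancel_left' orthogonal_def span_eq_iff)
  then obtain p where p: "\<And>x. p x \<in> S" "\<And>x w. w \<in> S \<Longrightarrow> (x - p x) \<bullet> w = 0"
    by metis
  \<comment> \<open>A residual orthogonal to \<open>S\<close> pins down the projection; additivity,
    homogeneity and the fixed points all follow from this criterion.\<close>
  have p_eqI: "p x = y" if "y \<in> S" "\<And>w. w \<in> S \<Longrightarrow> (x - y) \<bullet> w = 0" for x y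
  proof -
    have d: "p x - y \<in> S" using p that S by (simp add: subspace_diff)
    have "(p x - y) \<bullet> (p x - y) = (x - y) \<bullet> (p x - y) - (x - p x) \<bullet> (p x - y)"
      by (simp add: inner_diff_left)
    then show ?thesis using that(2)[OF d] p(2)[OF d] by simp
  qed
  have add: "p (x + y) = p x + p y" for x y
  proof (rule p_eqI)
    show "p x + p y \<in> S" using p S by (simp add: subspace_add)
    show "(x + y - (p x + p y)) \<bullet> w = 0" if "w \<in> S" for w
      using p(2)[OF that, of x] p(2)[OF that, of y] by (simp add: inner_diff_left inner_add_left)
  qed
  have scale: "p (c *s x) = c *s p x" for c x
  proof (rule p_eqI)
    show "c *s p x \<in> S" using p S_scalar by blast
    show "(c *s x - c *s p x) \<bullet> w = 0" if "w \<in> S" for w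
      using p(2)[OF S_scalar[OF that], of x "cnj c"]
      by (simp add: inner_vector_scalar_mult vector_sub_rdistrib[symmetric])
  qed
  define P where "P = matrix p"
  have lin: "Vector_Spaces.linear (*s) (*s) p"
    by (simp add: Vector_Spaces.linear_iff vec.vector_space_axioms add scale)
  have P: "P *v x = p x" for x
    unfolding P_def using lin by (rule matrix_works)
  have fixed: "p x = x" if "x \<in> S" for x using that by (intro p_eqI) auto
  have sym: "p x \<bullet> y = p x \<bullet> p y" for x y
    using p(2)[OF p(1), of y x] by (simp add: inner_diff_left inner_commute[of "p x"])
  have "conj_transpose P = P"
  proof (rule matrix_eq_inner)
    fix x y
    have "x \<bullet> (conj_transpose P *v y) = p x \<bullet> y"
      using inner_matrix_vector_mult[of x "conj_transpose P" y] by (simp add: P)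
    also have "\<dots> = x \<bullet> p y" using sym[of x y] sym[of y x] by (simp add: inner_commute)
    finally show "x \<bullet> (conj_transpose P *v y) = x \<bullet> (P *v y)" by (simp add: P)
  qed
  moreover have "P ** P = P"
    by (simp add: matrix_eq matrix_vector_mul_assoc[symmetric] P fixed p(1))
  moreover have "range ((*v) P) = S"
  proof (intro equalityI subsetI)
    fix x assume "x \<in> S"
    then have "x = P *v x" by (simp add: P fixed)
    then show "x \<in> range ((*v) P)" by (rule range_eqI)
  qed (use p(1) in \<open>auto simp: P\<close>)
  ultimately show ?thesis by blast
qed

section \<open>Eigenprojections and the spectral theorem\<close>

locale hermitian_matrix =
  fixes H :: "complex^'n^'n"
  assumes hermitian: "conj_transpose H = H"
begin

abbreviation E where "E \<equiv> eigenprojection H"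

lemma inner_symmetric: "x \<bullet> (H *v y) = (H *v x) \<bullet> y"
  using inner_matrix_vector_mult[of x H y] by (simp add: hermitian)

lemma eigenspace_iff: "x \<in> eigenspace H \<theta> \<longleftrightarrow> H *v x = \<theta> *\<^sub>R x"
  by (simp add: eigenspace_def vector_scalar_mult_of_real)

lemma subspace_eigenspace: "subspace (eigenspace H \<theta>)"
  by (rule subspaceI)
    (auto simp: eigenspace_iff matrix_vector_right_distrib matrix_vector_mult_scaleR_complex
      scaleR_right_distrib)

lemma eigenprojection_props:
  shows eigenprojection_hermitian: "conj_transpose (E \<theta>) = E \<theta>"
    and eigenprojection_idem: "E \<theta> ** E \<theta> = E \<theta>"
    and range_eigenprojection: "range ((*v) (E \<theta>)) = eigenspace H \<theta>"
proof -
  have "c *s x \<in> eigenspace H \<theta>" if "x \<in> eigenspace H \<theta>" for c x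
    using that by (simp add: eigenspace_def vector_scalar_commute vector_smult_assoc mult.commute)
  then have "\<exists>!P. conj_transpose P = P \<and> P ** P = P \<and> range ((*v) P) = eigenspace H \<theta>"
    using orthogonal_projection_exists[OF subspace_eigenspace] orthogonal_projection_unique
    by (metis (no_types, lifting))
  from theI'[OF this] show "conj_transpose (E \<theta>) = E \<theta>" "E \<theta> ** E \<theta> = E \<theta>"
      "range ((*v) (E \<theta>)) = eigenspace H \<theta>"
    unfolding eigenprojection_def by blast+
qed

lemma eigenprojection_mem: "E \<theta> *v x \<in> eigenspace H \<theta>"
  using range_eigenprojection by blast

lemma eigenprojection_fixes: "x \<in> eigenspace H \<theta> \<Longrightarrow> E \<theta> *v x = x"
  using range_eigenprojection[of \<theta>] eigenprojection_idem[of \<theta>]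
  by (metis imageE matrix_vector_mul_assoc)

lemma inner_eigenprojection: "(E \<theta> *v x) \<bullet> y = x \<bullet> (E \<theta> *v y)"
  using inner_matrix_vector_mult[of x "E \<theta>" y] by (simp add: eigenprojection_hermitian)

lemma eigenspaces_orthogonal:
  assumes "x \<in> eigenspace H \<theta>" "y \<in> eigenspace H \<mu>" "\<theta> \<noteq> \<mu>"
  shows "x \<bullet> y = 0"
proof -
  have "\<theta> * (x \<bullet> y) = \<mu> * (x \<bullet> y)"
    using inner_symmetric[of x y] assms by (simp add: eigenspace_iff)
  with assms(3) show ?thesis by simp
qed

lemma eigenprojection_orthogonal:
  assumes "x \<in> eigenspace H \<theta>" "\<theta> \<noteq> \<mu>"
  shows "E \<mu> *v x = 0"
proof -
  have "(E \<mu> *v x) \<bullet> (E \<mu> *v x) = x \<bullet> (E \<mu> *v (E \<mu> *v x))"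
    by (rule inner_eigenprojection)
  also have "\<dots> = 0"
    using assms by (intro eigenspaces_orthogonal[OF _ eigenprojection_mem])
  finally show ?thesis by simp
qed

text \<open>One eigenvector per eigenvalue gives a family of nonzero, pairwise orthogonal vectors,
  which must be finite in finite dimension.\<close>

lemma finite_eigenvalues: "finite (eigenvalues H)"
proof -
  define v where "v \<theta> = (SOME x. x \<noteq> 0 \<and> x \<in> eigenspace H \<theta>)" for \<theta>
  have v: "v \<theta> \<noteq> 0" "v \<theta> \<in> eigenspace H \<theta>" if "\<theta> \<in> eigenvalues H" for \<theta>
    using someI_ex[of "\<lambda>x. x \<noteq> 0 \<and> x \<in> eigenspace H \<theta>"] that
    by (auto simp: v_def eigenvalues_def)
  have orth: "v \<theta> \<bullet> v \<mu> = 0" if "\<theta> \<in> eigenvalues H" "\<mu> \<in> eigenvalues H" "\<theta> \<noteq> \<mu>" for \<theta> \<mu>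
    using that v eigenspaces_orthogonal by blast
  have "inj_on v (eigenvalues H)"
    using orth v by (metis inj_onI inner_eq_zero_iff)
  moreover have "pairwise orthogonal (v ` eigenvalues H)"
    using orth by (auto simp: pairwise_def orthogonal_def)
  then have "finite (v ` eigenvalues H)"
    by (rule pairwise_orthogonal_imp_finite)
  ultimately show ?thesis by (rule finite_imageD[rotated])
qed

text \<open>Variational argument: if the orthogonal complement \<open>V\<close> of all eigenspaces
  were nonzero, the Rayleigh quotient would attain its maximum on the unit sphere of
  \<open>V\<close>. The maximiser is an eigenvector lying in \<open>V\<close>, hence orthogonal to
  itself.\<close>

lemma eigenspaces_complete:
  assumes "\<And>\<theta> v. v \<in> eigenspace H \<theta> \<Longrightarrow> x \<bullet> v = 0"
  shows "x = 0"
proof (rule ccontr)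
  assume "x \<noteq> 0"
  define V where "V = {x. \<forall>\<theta> v. v \<in> eigenspace H \<theta> \<longrightarrow> x \<bullet> v = 0}"
  have V: "subspace V"
    by (rule subspaceI) (auto simp: V_def inner_add_left)
  have HV: "H *v y \<in> V" if "y \<in> V" for y
    using that by (auto simp: V_def inner_symmetric[symmetric] eigenspace_iff)
  have "compact (sphere 0 1 \<inter> V)"
    using V closed_subspace by (intro compact_Int_closed) auto
  moreover have "x /\<^sub>R norm x \<in> sphere 0 1 \<inter> V"
    using assms \<open>x \<noteq> 0\<close> V by (auto simp: V_def)
  moreover have "continuous_on (sphere 0 1 \<inter> V) (\<lambda>y. y \<bullet> (H *v y))"
    by (intro continuous_intros linear_continuous_on linear_conv_bounded_linear[THEN iffD1]
        linear_matrix_vector_mult_complex)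
  ultimately obtain u where u: "u \<in> sphere 0 1 \<inter> V"
    and max: "\<And>y. y \<in> sphere 0 1 \<inter> V \<Longrightarrow> y \<bullet> (H *v y) \<le> u \<bullet> (H *v u)"
    using continuous_attains_sup[of "sphere 0 1 \<inter> V" "\<lambda>y. y \<bullet> (H *v y)"] by blast
  define \<theta> where "\<theta> = u \<bullet> (H *v u)"
  \<comment> \<open>As \<open>\<theta>\<close> is the maximum of the Rayleigh quotient on
    \<open>V\<close>, this form is nonnegative on \<open>V\<close> and vanishes at
    \<open>u\<close>.\<close>
  define q where "q y = \<theta> * (y \<bullet> y) - y \<bullet> (H *v y)" for y
  have uu: "u \<bullet> u = 1" using u by (simp add: dot_square_norm)
  have q_nonneg: "q y \<ge> 0" if "y \<in> V" for y
  proof (cases "y = 0")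
    case False
    define z where "z = y /\<^sub>R norm y"
    have "z \<in> sphere 0 1 \<inter> V" using False that V by (simp add: z_def subspace_scale)
    then have "z \<bullet> (H *v z) \<le> \<theta>" using max by (simp add: \<theta>_def)
    moreover have "y = norm y *\<^sub>R z" using False by (simp add: z_def)
    then have "y \<bullet> (H *v y) = (norm y)\<^sup>2 * (z \<bullet> (H *v z))"
      by (metis inner_scaleR_left inner_scaleR_right matrix_vector_mult_scaleR_complex
          mult.assoc power2_eq_square)
    ultimately show ?thesis
      by (simp add: q_def dot_square_norm mult.commute mult_right_mono)
  qed (simp add: q_def)
  \<comment> \<open>The residual of the eigenvalue equation. Moving \<open>u\<close> along
    \<open>w\<close> changes \<open>q\<close> with linear coefficient
    \<open>2 * (w \<bullet> w)\<close>, which must vanish because \<open>q\<close> is minimal at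
    \<open>u\<close>.\<close>
  define w where "w = \<theta> *\<^sub>R u - H *v u"
  have wV: "w \<in> V" using u HV V by (simp add: w_def subspace_diff subspace_scale)
  have "q (u + t *\<^sub>R w) = 2 * t * (w \<bullet> w) + t\<^sup>2 * q w" for t
  proof -
    have *: "w \<bullet> (H *v u) = u \<bullet> (H *v w)" by (metis inner_symmetric inner_commute)
    have ww: "w \<bullet> w = \<theta> * (u \<bullet> w) - u \<bullet> (H *v w)"
      by (subst (1) w_def) (simp add: inner_diff_left inner_symmetric)
    then have uHw: "u \<bullet> (H *v w) = \<theta> * (u \<bullet> w) - w \<bullet> w" by simp
    show ?thesis
      unfolding q_def
      by (simp add: matrix_vector_right_distrib matrix_vector_mult_scaleR_complex
          inner_add_left inner_add_right * uHw uu \<theta>_def[symmetric] inner_commute[of w u]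
          algebra_simps power2_eq_square)
  qed
  then have quad: "0 \<le> 2 * t * (w \<bullet> w) + t\<^sup>2 * q w" for t
    using q_nonneg[of "u + t *\<^sub>R w"] u wV V by (simp add: subspace_add subspace_scale)
  have "w \<bullet> w = 0"
  proof (rule ccontr)
    assume "w \<bullet> w \<noteq> 0"
    then have pos: "w \<bullet> w > 0" by (simp add: order_less_le)
    have qw: "q w \<ge> 0" using q_nonneg wV by blast
    \<comment> \<open>A negative step small enough for the linear term to beat the quadratic one;
      the \<open>+ 1\<close> keeps the denominator positive when \<open>q w = 0\<close>.\<close>
    define t where "t = - (w \<bullet> w) / (q w + 1)"
    have ww: "w \<bullet> w = - t * (q w + 1)" using qw by (simp add: t_def)
    have "t \<noteq> 0" using pos ww by auto
    have "2 * t * (w \<bullet> w) + t\<^sup>2 * q w = - (t\<^sup>2 * (q w + 2))"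
      unfolding ww by (simp add: power2_eq_square algebra_simps)
    also have "\<dots> < 0" using \<open>t \<noteq> 0\<close> qw by (auto simp: zero_less_mult_iff)
    finally show False using quad[of t] by simp
  qed
  then have "u \<in> eigenspace H \<theta>" by (simp add: w_def eigenspace_iff)
  then have "u \<bullet> u = 0" using u by (auto simp: V_def)
  with uu show False by simp
qed

text \<open>The difference of the two sides is orthogonal to every eigenspace, so completeness makes
  it zero.\<close>

lemma sum_eigenprojections: "(\<Sum>\<theta>\<in>eigenvalues H. E \<theta> *v x) = x"
proof -
  have "x - (\<Sum>\<theta>\<in>eigenvalues H. E \<theta> *v x) = 0"
  proof (rule eigenspaces_complete)
    fix \<mu> v assume v: "v \<in> eigenspace H \<mu>"
    show "(x - (\<Sum>\<theta>\<in>eigenvalues H. E \<theta> *v x)) \<bullet> v = 0"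
    proof (cases "\<mu> \<in> eigenvalues H")
      case True
      have "(\<Sum>\<theta>\<in>eigenvalues H. (E \<theta> *v x) \<bullet> v) =
          (\<Sum>\<theta>\<in>eigenvalues H. if \<theta> = \<mu> then x \<bullet> v else 0)"
        using v by (intro sum.cong refl)
          (auto simp: inner_eigenprojection eigenprojection_fixes eigenprojection_orthogonal)
      then show ?thesis
        using True finite_eigenvalues by (simp add: inner_diff_left inner_sum_left)
    next
      case False
      then have "v = 0" using v by (auto simp: eigenvalues_def)
      then show ?thesis by simp
    qed
  qed
  then show ?thesis by simp
qed

lemma norm_eigenprojection_le: "norm (E \<theta> *v x) \<le> norm x"
proof -
  have "(norm (E \<theta> *v x))\<^sup>2 = x \<bullet> (E \<theta> *v x)"
    by (simp add: power2_norm_eq_inner inner_eigenprojection eigenprojection_fixes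
        eigenprojection_mem)
  also have "\<dots> \<le> norm x * norm (E \<theta> *v x)" by (rule norm_cauchy_schwarz)
  finally show ?thesis
    by (cases "E \<theta> *v x = 0") (simp_all add: power2_eq_square)
qed

text \<open>Parseval's identity for the spectral decomposition.\<close>

lemma sum_norm_eigenprojection: "(\<Sum>\<theta>\<in>eigenvalues H. (norm (E \<theta> *v x))\<^sup>2) = (norm x)\<^sup>2"
proof -
  have "(\<Sum>\<theta>\<in>eigenvalues H. (norm (E \<theta> *v x))\<^sup>2) = (\<Sum>\<theta>\<in>eigenvalues H. x \<bullet> (E \<theta> *v x))"
    by (simp add: power2_norm_eq_inner inner_eigenprojection eigenprojection_fixes
        eigenprojection_mem)
  also have "\<dots> = (norm x)\<^sup>2"
    by (simp add: inner_sum_right[symmetric] sum_eigenprojections power2_norm_eq_inner)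
  finally show ?thesis .
qed

lemma eigenprojection_sum_scaleR:
  assumes "\<mu> \<in> eigenvalues H"
  shows "E \<mu> *v (\<Sum>\<theta>\<in>eigenvalues H. c \<theta> *\<^sub>R (E \<theta> *v x)) = c \<mu> *\<^sub>R (E \<mu> *v x)"
proof -
  have "E \<mu> *v (\<Sum>\<theta>\<in>eigenvalues H. c \<theta> *\<^sub>R (E \<theta> *v x)) =
      (\<Sum>\<theta>\<in>eigenvalues H. c \<theta> *\<^sub>R (E \<mu> *v (E \<theta> *v x)))"
    by (simp add: linear_sum[OF linear_matrix_vector_mult_complex] matrix_vector_mult_scaleR_complex)
  also have "\<dots> = (\<Sum>\<theta>\<in>eigenvalues H. if \<theta> = \<mu> then c \<mu> *\<^sub>R (E \<mu> *v x) else 0)"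
    by (intro sum.cong refl)
      (auto simp: eigenprojection_fixes eigenprojection_mem
        eigenprojection_orthogonal[OF eigenprojection_mem])
  finally show ?thesis using assms finite_eigenvalues by simp
qed

text \<open>When all eigenvalues lie in [-1, 1], this is the Chebyshev polynomial of degree
  \<open>n\<close>, evaluated at \<open>H\<close> and applied to \<open>x\<close>.\<close>

definition chebyshev :: "nat \<Rightarrow> complex^'n \<Rightarrow> complex^'n" where
  "chebyshev n x = (\<Sum>\<theta>\<in>eigenvalues H. cos (real n * arccos \<theta>) *\<^sub>R (E \<theta> *v x))"

lemma inner_chebyshev: "chebyshev n x \<bullet> y = x \<bullet> chebyshev n y"
  by (simp add: chebyshev_def inner_sum_left inner_sum_right inner_eigenprojection)

end

section \<open>Walks generated by two reflections\<close>

lemma matrix_inv_eqI: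
  fixes A B :: "'a::semiring_1^'n^'n"
  assumes "A ** B = mat 1" "B ** A = mat 1"
  shows "matrix_inv A = B"
proof -
  have inv: "A ** matrix_inv A = mat 1"
    using someI_ex[of "\<lambda>A'. A ** A' = mat 1 \<and> A' ** A = mat 1"] assms
    by (auto simp: matrix_inv_def)
  have "matrix_inv A = (B ** A) ** matrix_inv A" using assms by simp
  also have "\<dots> = B" using inv by (simp add: matrix_mul_assoc[symmetric])
  finally show ?thesis .
qed

lemma mat_pow_commute: "A ** mat_pow A n = mat_pow A n ** A"
  by (induction n) (simp, metis mat_pow.simps(2) matrix_mul_assoc)

lemma mat_pow_Suc_vec: "mat_pow A (Suc n) *v x = mat_pow A n *v (A *v x)"
  by (simp add: mat_pow_commute matrix_vector_mul_assoc)

lemma inner_mat_pow_conj_transpose: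
  "x \<bullet> (mat_pow (conj_transpose A) n *v y) = (mat_pow A n *v x) \<bullet> y"
proof (induction n arbitrary: x)
  case (Suc n)
  have "x \<bullet> (mat_pow (conj_transpose A) (Suc n) *v y) =
      (A *v x) \<bullet> (mat_pow (conj_transpose A) n *v y)"
    using inner_matrix_vector_mult[of x "conj_transpose A"]
    by (simp add: matrix_vector_mul_assoc[symmetric])
  then show ?case by (simp only: Suc mat_pow_Suc_vec)
qed simp

lemma norm_coisometry_adjoint:
  assumes "N ** conj_transpose N = mat 1"
  shows "norm (conj_transpose N *v x) = norm x"
proof -
  have "(conj_transpose N *v x) \<bullet> (conj_transpose N *v x) = x \<bullet> x"
    using inner_matrix_vector_mult[of "conj_transpose N *v x" "conj_transpose N" x] assms
    by (simp add: matrix_vector_mul_assoc)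
  then show ?thesis by (simp add: norm_eq_sqrt_inner)
qed

text \<open>The adjoint preserves norms, so moving \<open>N\<close> across the inner product and
  applying Cauchy-Schwarz gives the contraction bound.\<close>

lemma norm_coisometry_le:
  assumes "N ** conj_transpose N = mat 1"
  shows "norm (N *v x) \<le> norm x"
proof -
  have "(norm (N *v x))\<^sup>2 = (conj_transpose N *v (N *v x)) \<bullet> x"
    by (simp add: power2_norm_eq_inner inner_matrix_vector_mult)
  also have "\<dots> \<le> norm (N *v x) * norm x"
    using norm_cauchy_schwarz[of "conj_transpose N *v (N *v x)" x]
    by (simp add: norm_coisometry_adjoint[OF assms])
  finally show ?thesis
    by (cases "N *v x = 0") (simp_all add: power2_eq_square)
qed

lemma norm_mat_pow_isometry:
  fixes A :: "complex^'n^'n"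
  assumes "\<And>x. norm (A *v x) = norm x"
  shows "norm (mat_pow A n *v x) = norm x"
  by (induction n) (simp_all add: assms matrix_vector_mul_assoc[symmetric])

text \<open>The graph enters the dynamics only through these three identities. They make both
  \<open>R\<close> and \<open>2 N* N - I\<close> reflections.\<close>

locale reflection_walk =
  fixes N :: "complex^'e^'v" and R :: "complex^'e^'e"
  assumes coisometry: "N ** conj_transpose N = mat 1"
    and R_hermitian: "conj_transpose R = R"
    and R_involution: "R ** R = mat 1"
begin

definition U :: "complex^'e^'e" where
  "U = R ** (2 *\<^sub>R (conj_transpose N ** N) - mat 1)"

definition H :: "complex^'v^'v" where
  "H = N ** R ** conj_transpose N"

sublocale hermitian_matrix H
  by standard (simp add: H_def conj_transpose_matrix_mult R_hermitian matrix_mul_assoc)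

lemma coisometry_vec [simp]: "N *v (conj_transpose N *v x) = x"
  by (simp add: matrix_vector_mul_assoc coisometry)

lemma R_vec [simp]: "R *v (R *v x) = x"
  by (simp add: matrix_vector_mul_assoc R_involution)

lemma reflection_vec:
  "(2 *\<^sub>R (conj_transpose N ** N) - mat 1) *v x = 2 *\<^sub>R (conj_transpose N *v (N *v x)) - x"
  by (simp only: matrix_vector_mult_diff_rdistrib scaleR_matrix_vector_mult_complex
      matrix_vector_mul_assoc matrix_vector_mul_lid)

lemma U_vec: "U *v x = R *v (2 *\<^sub>R (conj_transpose N *v (N *v x)) - x)"
  by (simp add: U_def matrix_vector_mul_assoc[symmetric] reflection_vec)

text \<open>Both factors of \<open>U\<close> are Hermitian involutions, the second one because
  \<open>N* N\<close> is an orthogonal projection.\<close>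

lemma U_unitary: "conj_transpose U ** U = mat 1" "U ** conj_transpose U = mat 1"
proof -
  let ?Q = "2 *\<^sub>R (conj_transpose N ** N) - mat 1"
  have "conj_transpose ?Q = ?Q"
  proof (rule matrix_eq_inner)
    fix x y
    show "x \<bullet> (conj_transpose ?Q *v y) = x \<bullet> (?Q *v y)"
      by (simp add: inner_matrix_vector_mult[of x "conj_transpose ?Q"] reflection_vec
          inner_diff_left inner_diff_right inner_matrix_vector_mult[of x "conj_transpose N"]
          inner_matrix_vector_mult[of _ N])
  qed
  moreover have "?Q ** ?Q = mat 1"
  proof -
    have "?Q *v (?Q *v x) = x" for x
      by (simp only: reflection_vec matrix_vector_mult_diff_distrib
          matrix_vector_mult_scaleR_complex coisometry_vec) (simp add: scaleR_2)
    then show ?thesis by (simp only: matrix_eq matrix_vector_mul_assoc matrix_vector_mul_lid simp_thms)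
  qed
  ultimately have "conj_transpose U = ?Q ** R" "?Q ** ?Q = mat 1"
    by (simp_all add: U_def conj_transpose_matrix_mult R_hermitian)
  then show "conj_transpose U ** U = mat 1" "U ** conj_transpose U = mat 1"
    unfolding U_def using R_involution
    by (metis matrix_mul_assoc matrix_mul_rid)+
qed

lemma norm_mat_int_pow_U: "norm (mat_int_pow U t *v x) = norm x"
proof -
  have "norm (U *v x) = norm x" "norm (conj_transpose U *v x) = norm x" for x
    using norm_coisometry_adjoint[of "conj_transpose U" x] norm_coisometry_adjoint[of U x] U_unitary
    by simp_all
  then show ?thesis
    using matrix_inv_eqI[of U "conj_transpose U"] U_unitary
    by (simp add: mat_int_pow_def norm_mat_pow_isometry)
qed

text \<open>\<open>H\<close> is the compression of the norm-preserving \<open>R\<close> by a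
  coisometry, hence a contraction. This places the eigenvalues where \<open>arccos\<close> inverts
  \<open>cos\<close>.\<close>

lemma eigenvalue_bound:
  assumes "\<theta> \<in> eigenvalues H"
  shows "\<bar>\<theta>\<bar> \<le> 1"
proof -
  obtain z where z: "z \<noteq> 0" "H *v z = \<theta> *\<^sub>R z"
    using assms by (auto simp: eigenvalues_def eigenspace_iff)
  have "\<bar>\<theta>\<bar> * norm z = norm (N *v (R *v (conj_transpose N *v z)))"
    using z(2) by (metis H_def matrix_vector_mul_assoc norm_scaleR)
  also have "\<dots> \<le> norm (R *v (conj_transpose N *v z))"
    by (rule norm_coisometry_le[OF coisometry])
  also have "\<dots> = norm z"
    using norm_coisometry_adjoint[of R "conj_transpose N *v z"]
    by (simp add: R_hermitian R_involution norm_coisometry_adjoint[OF coisometry])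
  finally show ?thesis using z(1) by simp
qed

text \<open>
  On the span of \<open>conj_transpose N *v z\<close> and its image under \<open>R\<close>, the matrix \<open>U\<close> satisfies
  \<open>U\<^sup>2 - 2 \<theta> U + 1 = 0\<close>, which is the recursion of the Chebyshev polynomials.
\<close>

lemma walk_on_eigenvector:
  assumes \<theta>: "\<bar>\<theta>\<bar> \<le> 1" and z: "z \<in> eigenspace H \<theta>"
  shows "N *v (mat_pow U n *v (conj_transpose N *v z)) = cos (real n * arccos \<theta>) *\<^sub>R z"
proof -
  define y where "y = conj_transpose N *v z"
  have Uy: "U *v y = R *v y"
    by (simp add: U_vec y_def scaleR_2)
  have NRy: "N *v (R *v y) = \<theta> *\<^sub>R z"
    using z unfolding eigenspace_iff
    by (simp add: y_def H_def matrix_vector_mul_assoc matrix_mul_assoc)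
  have UUy: "U *v (U *v y) = (2 * \<theta>) *\<^sub>R (U *v y) - y"
    by (simp add: Uy, subst U_vec)
      (simp add: NRy matrix_vector_mult_diff_distrib matrix_vector_mult_scaleR_complex y_def[symmetric])
  \<comment> \<open>The recursion has order two, so the induction carries two consecutive
    powers.\<close>
  have "N *v (mat_pow U n *v y) = cos (real n * arccos \<theta>) *\<^sub>R z \<and>
      N *v (mat_pow U (Suc n) *v y) = cos (real (Suc n) * arccos \<theta>) *\<^sub>R z" for n
  proof (induction n)
    case 0
    then show ?case using \<theta> by (simp add: y_def[symmetric] Uy NRy cos_arccos_abs) (simp add: y_def)
  next
    case (Suc n)
    have "mat_pow U (Suc (Suc n)) *v y = (2 * \<theta>) *\<^sub>R (mat_pow U (Suc n) *v y) - mat_pow U n *v y"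
      by (simp only: mat_pow_Suc_vec UUy matrix_vector_mult_diff_distrib
          matrix_vector_mult_scaleR_complex)
    then have "N *v (mat_pow U (Suc (Suc n)) *v y) =
        (2 * \<theta> * cos (real (Suc n) * arccos \<theta>) - cos (real n * arccos \<theta>)) *\<^sub>R z"
      using Suc
      by (simp only: matrix_vector_mult_diff_distrib matrix_vector_mult_scaleR_complex
          scaleR_scaleR scaleR_left_diff_distrib)
    also have "2 * \<theta> * cos (real (Suc n) * arccos \<theta>) - cos (real n * arccos \<theta>) =
        cos (real (Suc (Suc n)) * arccos \<theta>)"
    proof -
      have "real (Suc (Suc n)) * arccos \<theta> = real (Suc n) * arccos \<theta> + arccos \<theta>"
        "real n * arccos \<theta> = real (Suc n) * arccos \<theta> - arccos \<theta>"
        by (simp_all add: algebra_simps)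
      then show ?thesis using \<theta> by (simp only: cos_add cos_diff cos_arccos_abs) simp
    qed
    finally show ?case using Suc by blast
  qed
  then show ?thesis by (simp add: y_def)
qed

lemma walk_eq_chebyshev: "N *v (mat_pow U n *v (conj_transpose N *v x)) = chebyshev n x"
proof -
  have "linear (\<lambda>x. N *v (mat_pow U n *v (conj_transpose N *v x)))"
    by (simp add: matrix_vector_mul_assoc linear_matrix_vector_mult_complex)
  from linear_sum[OF this, of "\<lambda>\<theta>. E \<theta> *v x" "eigenvalues H"] show ?thesis
    unfolding sum_eigenprojections chebyshev_def
    by (simp only: walk_on_eigenvector[OF eigenvalue_bound eigenprojection_mem] cong: sum.cong)
qed

lemma norm_chebyshev_le: "norm (chebyshev n x) \<le> norm x"
  using norm_coisometry_le[OF coisometry, of "mat_pow U n *v (conj_transpose N *v x)"]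
    norm_mat_int_pow_U[of "int n"]
  by (simp add: walk_eq_chebyshev mat_int_pow_def norm_coisometry_adjoint[OF coisometry])

text \<open>A negative power of the unitary \<open>U\<close> is a power of its adjoint and moves to
  the other side as a positive power. As \<open>chebyshev\<close> is self-adjoint, only the absolute
  value of \<open>t\<close> matters.\<close>

lemma walk_overlap:
  "(conj_transpose N *v y) \<bullet> (mat_int_pow U t *v (conj_transpose N *v x)) =
    y \<bullet> chebyshev (nat \<bar>t\<bar>) x"
proof (cases "t \<ge> 0")
  case True
  then show ?thesis
    by (simp add: mat_int_pow_def inner_matrix_vector_mult[of y N, symmetric] walk_eq_chebyshev)
next
  case False
  have "matrix_inv U = conj_transpose U"
    using U_unitary by (intro matrix_inv_eqI)
  then have "(conj_transpose N *v y) \<bullet> (mat_int_pow U t *v (conj_transpose N *v x)) =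
      (mat_pow U (nat \<bar>t\<bar>) *v (conj_transpose N *v y)) \<bullet> (conj_transpose N *v x)"
    using False by (simp add: mat_int_pow_def inner_mat_pow_conj_transpose)
  also have "\<dots> = chebyshev (nat \<bar>t\<bar>) y \<bullet> x"
    by (simp add: inner_matrix_vector_mult[of _ "conj_transpose N"] walk_eq_chebyshev)
  finally show ?thesis by (simp add: inner_chebyshev)
qed

text \<open>The walk preserves norms, so the distance between these unit vectors depends only on
  their overlap.\<close>

lemma norm_walk_diff:
  assumes "norm x = 1" "norm y = 1"
  shows "(norm (mat_int_pow U t *v (conj_transpose N *v x) - conj_transpose N *v y))\<^sup>2 =
    2 - 2 * (y \<bullet> chebyshev (nat \<bar>t\<bar>) x)"
  using assms norm_mat_int_pow_U[of t "conj_transpose N *v x"]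
    walk_overlap[of y t x]
    dot_norm_neg[of "mat_int_pow U t *v (conj_transpose N *v x)" "conj_transpose N *v y"]
  by (simp add: norm_coisometry_adjoint[OF coisometry]
      inner_commute[of _ "conj_transpose N *v y"])

text \<open>The two distances control each other. The Chebyshev distance is at most the walk
  distance because \<open>chebyshev n\<close> is a contraction; the squared walk distance is at most
  twice the Chebyshev distance by Cauchy-Schwarz.\<close>

lemma pgst_iff_chebyshev:
  assumes "norm x = 1" "norm y = 1"
  shows "pgst U (conj_transpose N *v x) (conj_transpose N *v y) \<longleftrightarrow>
    (\<exists>\<gamma>. cmod \<gamma> = 1 \<and> (\<forall>\<epsilon>>0. \<exists>n. norm (chebyshev n x - \<gamma> *s y) < \<epsilon>))"
proof -
  have "(\<forall>\<epsilon>>0. \<exists>t::int.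
          norm (mat_int_pow U t *v (conj_transpose N *v x) - \<gamma> *s (conj_transpose N *v y)) < \<epsilon>) \<longleftrightarrow>
      (\<forall>\<epsilon>>0. \<exists>n. norm (chebyshev n x - \<gamma> *s y) < \<epsilon>)" (is "?L \<longleftrightarrow> ?R")
    if \<gamma>: "cmod \<gamma> = 1" for \<gamma>
  proof -
    define w where "w = \<gamma> *s y"
    have w: "norm w = 1" using \<gamma> assms by (simp add: w_def norm_vector_scalar_mult)
    have Nw: "\<gamma> *s (conj_transpose N *v y) = conj_transpose N *v w"
      by (simp add: w_def vector_scalar_commute)
    note diff = norm_walk_diff[OF assms(1) w]
    have cheb_le: "norm (chebyshev n x - w) \<le>
        norm (mat_int_pow U t *v (conj_transpose N *v x) - conj_transpose N *v w)"
      if "n = nat \<bar>t\<bar>" for n t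
    proof -
      have "(norm (chebyshev n x - w))\<^sup>2 = (norm (chebyshev n x))\<^sup>2 + 1 - 2 * (w \<bullet> chebyshev n x)"
        using w dot_norm_neg[of "chebyshev n x" w]
        by (simp add: inner_commute[of w "chebyshev n x"])
      moreover have "(norm (chebyshev n x))\<^sup>2 \<le> 1"
        using norm_chebyshev_le[of n x] assms by (simp add: power_le_one)
      ultimately have "(norm (chebyshev n x - w))\<^sup>2 \<le>
          (norm (mat_int_pow U t *v (conj_transpose N *v x) - conj_transpose N *v w))\<^sup>2"
        unfolding diff that by linarith
      then show ?thesis by (rule power2_le_imp_le) simp
    qed
    have walk_le: "(norm (mat_int_pow U (int n) *v (conj_transpose N *v x) - conj_transpose N *v w))\<^sup>2
        \<le> 2 * norm (chebyshev n x - w)" for n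
    proof -
      have "1 - w \<bullet> chebyshev n x = w \<bullet> (w - chebyshev n x)"
        using w by (simp add: inner_diff_right dot_square_norm)
      also have "\<dots> \<le> norm (chebyshev n x - w)"
        using norm_cauchy_schwarz[of w "w - chebyshev n x"] w by (simp add: norm_minus_commute)
      finally show ?thesis using diff[of "int n"] by simp
    qed
    show ?thesis
      unfolding Nw w_def[symmetric]
    proof (intro iffI allI impI)
      fix \<epsilon> :: real
      assume "\<forall>\<epsilon>>0. \<exists>t::int.
          norm (mat_int_pow U t *v (conj_transpose N *v x) - conj_transpose N *v w) < \<epsilon>"
        and "0 < \<epsilon>"
      then show "\<exists>n. norm (chebyshev n x - w) < \<epsilon>"
        using cheb_le[OF refl] by (meson order.strict_trans1)
    next
      fix \<epsilon> :: real
      assume R: "\<forall>\<epsilon>>0. \<exists>n. norm (chebyshev n x - w) < \<epsilon>" and "0 < \<epsilon>"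
      \<comment> \<open>The tolerance is quadratic in \<open>\<epsilon>\<close> because the reverse
        estimate bounds the square of the walk distance.\<close>
      then obtain n where "norm (chebyshev n x - w) < \<epsilon>\<^sup>2 / 2"
        by (meson half_gt_zero zero_less_power)
      then have "(norm (mat_int_pow U (int n) *v (conj_transpose N *v x) - conj_transpose N *v w))\<^sup>2
          < \<epsilon>\<^sup>2"
        using walk_le[of n] by simp
      then show "\<exists>t::int.
          norm (mat_int_pow U t *v (conj_transpose N *v x) - conj_transpose N *v w) < \<epsilon>"
        using \<open>0 < \<epsilon>\<close> power2_less_imp_less by (meson less_imp_le)
    qed
  qed
  then show ?thesis unfolding pgst_def by blast
qed

end

section \<open>Approximation of signs by Chebyshev polynomials of a Hermitian matrix\<close>

text \<open>Translates between the parity condition on \<open>l\<close> and the multiplicative form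
  of the hypothesis in \<open>kronecker_sign_targets\<close>.\<close>

lemma prod_sign_powi:
  fixes l :: "'a \<Rightarrow> int"
  assumes "finite A"
  shows "(\<Prod>x\<in>A. (if x \<in> M then -1 else 1 :: real) powi l x) =
    (if even (\<Sum>x\<in>A \<inter> M. l x) then 1 else -1)"
  using assms by (induction A rule: finite_induct) (auto simp: power_int_minus_left)

lemma rcong_0_2pi_iff_cos: "[x = 0] (rmod (2 * pi)) \<longleftrightarrow> cos x = 1"
proof
  assume "[x = 0] (rmod (2 * pi))"
  then obtain k where "x = - of_int k * 2 * pi"
    by (auto simp: rcong_altdef algebra_simps eq_neg_iff_add_eq_0)
  then show "cos x = 1"
    unfolding cos_one_2pi_int by (intro exI[of _ "- k"]) simp
next
  assume "cos x = 1"
  then obtain k where "x = of_int k * 2 * pi"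
    by (auto simp: cos_one_2pi_int)
  then show "[x = 0] (rmod (2 * pi))"
    unfolding rcong_altdef by (intro exI[of _ "- k"]) simp
qed

text \<open>When the cosines tend to a sign, the squared sines tend to 0, so the whole unit complex
  number converges.\<close>

lemma cis_multiple_tendsto_sign:
  fixes m :: "nat \<Rightarrow> nat" and r \<phi> :: real
  assumes "(\<lambda>k. cos (real (m k) * \<phi>)) \<longlonglongrightarrow> r" "\<bar>r\<bar> = 1"
  shows "(\<lambda>k. cis (real (m k) * \<phi>)) \<longlonglongrightarrow> of_real r"
proof -
  have "(\<lambda>k. 1 - (cos (real (m k) * \<phi>))\<^sup>2) \<longlonglongrightarrow> 1 - r\<^sup>2"
    by (intro tendsto_intros assms)
  moreover have "r\<^sup>2 = 1" using assms(2) by (simp add: power2_eq_1_iff abs_if split: if_splits)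
  ultimately have "(\<lambda>k. (sin (real (m k) * \<phi>))\<^sup>2) \<longlonglongrightarrow> 0"
    by (simp add: sin_squared_eq)
  then have "(\<lambda>k. sin (real (m k) * \<phi>)) \<longlonglongrightarrow> 0"
    using tendsto_real_sqrt[of _ 0] by (fastforce simp: tendsto_rabs_zero_iff)
  with assms(1) show ?thesis
    by (simp add: tendsto_complex_iff)
qed

section \<open>Necessity and sufficiency for the Chebyshev iterates\<close>

context hermitian_matrix
begin

lemma chebyshev_pgst_necessary:
  assumes \<gamma>: "cmod \<gamma> = 1"
    and lim: "\<forall>\<epsilon>>0. \<exists>n. norm (chebyshev n (axis a 1) - \<gamma> *s axis b 1) < \<epsilon>"
  shows "strongly_cospectral H a b"
    and "eigenvalue_support H a = plus_set H \<gamma> a b \<union> minus_set H \<gamma> a b"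
    and "[(\<Sum>\<theta>\<in>eigenvalue_support H a. of_int (l \<theta>) * arccos \<theta>) = 0] (rmod (2 * pi))
          \<Longrightarrow> even (\<Sum>\<theta>\<in>minus_set H \<gamma> a b. l \<theta>)"
proof -
  define u where "u \<theta> = E \<theta> *v axis a 1" for \<theta>
  define v where "v \<theta> = \<gamma> *s (E \<theta> *v axis b 1)" for \<theta>
  \<comment> \<open>Tolerances \<open>1 / (k + 1)\<close> turn the approximation property into one
    sequence of times \<open>m\<close>, along which every eigencomponent converges.\<close>
  have "\<forall>k. \<exists>n. norm (chebyshev n (axis a 1) - \<gamma> *s axis b 1) < inverse (real (Suc k))"
    using lim by (simp del: of_nat_Suc)
  then obtain m where
    m: "\<And>k. norm (chebyshev (m k) (axis a 1) - \<gamma> *s axis b 1) < inverse (real (Suc k))"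
    by metis
  have conv: "(\<lambda>k. cos (real (m k) * arccos \<theta>) *\<^sub>R u \<theta>) \<longlonglongrightarrow> v \<theta>" if \<theta>: "\<theta> \<in> eigenvalues H" for \<theta>
  proof -
    have "(\<lambda>k. cos (real (m k) * arccos \<theta>) *\<^sub>R u \<theta> - v \<theta>) \<longlonglongrightarrow> 0"
    proof (rule Lim_null_comparison)
      have "norm (cos (real (m k) * arccos \<theta>) *\<^sub>R u \<theta> - v \<theta>) \<le> inverse (real (Suc k))" for k
      proof -
        have "cos (real (m k) * arccos \<theta>) *\<^sub>R u \<theta> - v \<theta> =
            E \<theta> *v (chebyshev (m k) (axis a 1) - \<gamma> *s axis b 1)"
          unfolding matrix_vector_mult_diff_distrib chebyshev_def eigenprojection_sum_scaleR[OF \<theta>]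
          by (simp add: u_def v_def vector_scalar_commute)
        then show ?thesis
          using norm_eigenprojection_le[of \<theta> "chebyshev (m k) (axis a 1) - \<gamma> *s axis b 1"] m[of k]
          by simp
      qed
      then show "\<forall>\<^sub>F k in sequentially.
          norm (cos (real (m k) * arccos \<theta>) *\<^sub>R u \<theta> - v \<theta>) \<le> inverse (real (Suc k))"
        by simp
    qed (rule LIMSEQ_inverse_real_of_nat)
    then show ?thesis by (simp add: LIM_zero_iff)
  qed

  \<comment> \<open>A cosine has modulus at most 1, so no component can grow in the limit. Parseval
    makes the total squared norms agree, which forces equality in every component.\<close>
  have "norm (v \<theta>) \<le> norm (u \<theta>)" if "\<theta> \<in> eigenvalues H" for \<theta>
    using tendsto_norm[OF conv[OF that]]
    by (rule LIMSEQ_le_const2) (auto intro!: mult_left_le_one_le)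
  then have le: "(norm (v \<theta>))\<^sup>2 \<le> (norm (u \<theta>))\<^sup>2" if "\<theta> \<in> eigenvalues H" for \<theta>
    using that by (simp add: power_mono)
  have "(\<Sum>\<theta>\<in>eigenvalues H. (norm (v \<theta>))\<^sup>2) = (\<Sum>\<theta>\<in>eigenvalues H. (norm (u \<theta>))\<^sup>2)"
    using \<gamma> by (simp add: u_def v_def norm_vector_scalar_mult sum_norm_eigenprojection)
  then have "(norm (v \<theta>))\<^sup>2 = (norm (u \<theta>))\<^sup>2" if "\<theta> \<in> eigenvalues H" for \<theta>
    using sum_mono_inv[of "\<lambda>\<theta>. (norm (v \<theta>))\<^sup>2" "eigenvalues H" "\<lambda>\<theta>. (norm (u \<theta>))\<^sup>2"]
      le that finite_eigenvalues by blast
  then have norm_eq: "norm (v \<theta>) = norm (u \<theta>)" if "\<theta> \<in> eigenvalues H" for \<theta>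
    using that by simp

  have "\<exists>r. (r = 1 \<or> r = -1) \<and> u \<theta> = r *\<^sub>R v \<theta> \<and>
      (u \<theta> \<noteq> 0 \<longrightarrow> (\<lambda>k. cos (real (m k) * arccos \<theta>)) \<longlonglongrightarrow> r)" if \<theta>: "\<theta> \<in> eigenvalues H" for \<theta>
  proof (cases "u \<theta> = 0")
    case True
    then show ?thesis using norm_eq[OF \<theta>] by auto
  next
    case False
    \<comment> \<open>The limit of the cosines, read off by pairing with the nonzero
      \<open>u \<theta>\<close>. Equality of norms then makes it a sign.\<close>
    define r where "r = (v \<theta> \<bullet> u \<theta>) / (u \<theta> \<bullet> u \<theta>)"
    have "(\<lambda>k. ((cos (real (m k) * arccos \<theta>) *\<^sub>R u \<theta>) \<bullet> u \<theta>) / (u \<theta> \<bullet> u \<theta>)) \<longlonglongrightarrow> r"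
      unfolding r_def using False by (intro tendsto_intros conv[OF \<theta>]) auto
    then have r: "(\<lambda>k. cos (real (m k) * arccos \<theta>)) \<longlonglongrightarrow> r"
      using False by simp
    then have "(\<lambda>k. cos (real (m k) * arccos \<theta>) *\<^sub>R u \<theta>) \<longlonglongrightarrow> r *\<^sub>R u \<theta>"
      by (intro tendsto_intros)
    then have vr: "v \<theta> = r *\<^sub>R u \<theta>"
      using conv[OF \<theta>] LIMSEQ_unique by blast
    then have "\<bar>r\<bar> = 1" using norm_eq[OF \<theta>] False by simp
    then have "r = 1 \<or> r = -1" by auto
    with vr r show ?thesis by auto
  qed
  then obtain r where r: "\<And>\<theta>. \<theta> \<in> eigenvalues H \<Longrightarrow> r \<theta> = 1 \<or> r \<theta> = -1"
    and uv: "\<And>\<theta>. \<theta> \<in> eigenvalues H \<Longrightarrow> u \<theta> = r \<theta> *\<^sub>R v \<theta>"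
    and rlim: "\<And>\<theta>. \<theta> \<in> eigenvalues H \<Longrightarrow> u \<theta> \<noteq> 0 \<Longrightarrow>
      (\<lambda>k. cos (real (m k) * arccos \<theta>)) \<longlonglongrightarrow> r \<theta>"
    by metis

  have neg: "(- \<gamma>) *s x = - (\<gamma> *s x)" for x :: "complex^'n"
    by (simp add: vec_eq_iff)
  \<comment> \<open>Ensures that a nonzero component cannot lie in both sign sets, so
    \<open>r\<close> is determined by membership in the minus set.\<close>
  have self_neg: "x = - x \<longleftrightarrow> x = 0" for x :: "complex^'n"
    by (simp add: vec_eq_iff complex_eq_iff)
  have supp: "eigenvalue_support H a = {\<theta>\<in>eigenvalues H. u \<theta> \<noteq> 0}"
    by (simp add: eigenvalue_support_def u_def)
  have plus: "plus_set H \<gamma> a b = {\<theta>\<in>eigenvalues H. u \<theta> = v \<theta> \<and> v \<theta> \<noteq> 0}"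
    by (simp add: plus_set_def u_def v_def)
  have minus: "minus_set H \<gamma> a b = {\<theta>\<in>eigenvalues H. u \<theta> = - v \<theta> \<and> v \<theta> \<noteq> 0}"
    by (simp add: minus_set_def u_def v_def neg)

  show "strongly_cospectral H a b"
    unfolding strongly_cospectral_def
  proof
    fix \<theta> assume \<theta>: "\<theta> \<in> eigenvalues H"
    have "u \<theta> = (of_real (r \<theta>) * \<gamma>) *s (E \<theta> *v axis b 1)"
      using uv[OF \<theta>] by (metis v_def vector_scalar_mult_of_real vector_smult_assoc)
    moreover have "cmod (of_real (r \<theta>) * \<gamma>) = 1"
      using r[OF \<theta>] \<gamma> by (auto simp: norm_mult)
    ultimately show "\<exists>\<mu>. cmod \<mu> = 1 \<and> E \<theta> *v axis a 1 = \<mu> *s (E \<theta> *v axis b 1)"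
      unfolding u_def by blast
  qed

  show "eigenvalue_support H a = plus_set H \<gamma> a b \<union> minus_set H \<gamma> a b"
    unfolding supp plus minus using r uv by fastforce

  assume rel: "[(\<Sum>\<theta>\<in>eigenvalue_support H a. of_int (l \<theta>) * arccos \<theta>) = 0] (rmod (2 * pi))"
  let ?S = "eigenvalue_support H a" and ?M = "minus_set H \<gamma> a b"
  have fin: "finite ?S" using finite_eigenvalues by (simp add: supp)
  \<comment> \<open>This product is constantly 1 by the integer relation among the angles, while its
    limit is the product of the signs. That product is therefore 1, which is the parity
    claim.\<close>
  have "(\<lambda>k. \<Prod>\<theta>\<in>?S. cis (real (m k) * arccos \<theta>) powi l \<theta>)
      \<longlonglongrightarrow> (\<Prod>\<theta>\<in>?S. complex_of_real (r \<theta>) powi l \<theta>)"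
  proof (intro tendsto_prod tendsto_power_int cis_multiple_tendsto_sign)
    fix \<theta> assume "\<theta> \<in> ?S"
    then show "(\<lambda>k. cos (real (m k) * arccos \<theta>)) \<longlonglongrightarrow> r \<theta>" "\<bar>r \<theta>\<bar> = 1" "complex_of_real (r \<theta>) \<noteq> 0"
      using rlim[of \<theta>] r[of \<theta>] by (auto simp: supp)
  qed
  moreover have "(\<Prod>\<theta>\<in>?S. cis (real n * arccos \<theta>) powi l \<theta>) = 1" for n
  proof -
    obtain j where j: "(\<Sum>\<theta>\<in>?S. of_int (l \<theta>) * arccos \<theta>) = of_int j * 2 * pi"
      using rel by (auto simp: rcong_0_2pi_iff_cos cos_one_2pi_int)
    have "(\<Prod>\<theta>\<in>?S. cis (real n * arccos \<theta>) powi l \<theta>) =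
        cis (\<Sum>\<theta>\<in>?S. of_int (l \<theta>) * (real n * arccos \<theta>))"
      using prod_powi_times_cis[OF fin, of "\<lambda>_. 1"] by simp
    also have "(\<Sum>\<theta>\<in>?S. of_int (l \<theta>) * (real n * arccos \<theta>)) = 2 * pi * of_int (int n * j)"
      using arg_cong[OF j, of "\<lambda>x. real n * x"] by (simp add: sum_distrib_left mult_ac)
    also have "cis \<dots> = 1"
      by (rule cis_multiple_2pi) (rule Ints_of_int)
    finally show ?thesis .
  qed
  ultimately have "(\<Prod>\<theta>\<in>?S. complex_of_real (r \<theta>) powi l \<theta>) = 1"
    by (simp add: LIMSEQ_const_iff)
  then have "complex_of_real (\<Prod>\<theta>\<in>?S. r \<theta> powi l \<theta>) = 1"
    by simp
  then have "(\<Prod>\<theta>\<in>?S. r \<theta> powi l \<theta>) = 1"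
    unfolding of_real_eq_1_iff .
  moreover have "r \<theta> = (if \<theta> \<in> ?M then -1 else 1)" if "\<theta> \<in> ?S" for \<theta>
    using that r[of \<theta>] uv[of \<theta>] by (auto simp: supp minus self_neg)
  moreover have "?S \<inter> ?M = ?M"
    by (auto simp: supp minus)
  ultimately show "even (\<Sum>\<theta>\<in>?M. l \<theta>)"
    using prod_sign_powi[OF fin, of ?M l] by (simp split: if_splits)
qed

lemma chebyshev_pgst_sufficient:
  assumes cosp: "strongly_cospectral H a b"
    and supp: "eigenvalue_support H a = plus_set H \<gamma> a b \<union> minus_set H \<gamma> a b"
    and rel: "\<forall>l. [(\<Sum>\<theta>\<in>eigenvalue_support H a. of_int (l \<theta>) * arccos \<theta>) = 0] (rmod (2 * pi))
          \<longrightarrow> even (\<Sum>\<theta>\<in>minus_set H \<gamma> a b. l \<theta>)"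
    and "\<epsilon> > 0"
  shows "\<exists>n. norm (chebyshev n (axis a 1) - \<gamma> *s axis b 1) < \<epsilon>"
proof -
  let ?S = "eigenvalue_support H a" and ?M = "minus_set H \<gamma> a b"
  define s :: "real \<Rightarrow> real" where "s \<theta> = (if \<theta> \<in> ?M then -1 else 1)" for \<theta>
  define u where "u \<theta> = E \<theta> *v axis a 1" for \<theta>
  have fin: "finite ?S" using finite_eigenvalues by (simp add: eigenvalue_support_def)
  have SM: "?S \<inter> ?M = ?M" using supp by blast
  \<comment> \<open>Each eigenvalue will contribute an error of at most \<open>\<delta>\<close>; the
    \<open>+ 1\<close> makes the total strictly smaller than \<open>\<epsilon>\<close>.\<close>
  define \<delta> where "\<delta> = \<epsilon> / (card (eigenvalues H) + 1)"
  have \<delta>: "\<delta> > 0" using \<open>\<epsilon> > 0\<close> by (simp add: \<delta>_def)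
  have "\<exists>n. \<forall>\<theta>\<in>?S. s \<theta> * cos (real n * arccos \<theta>) > 1 - \<delta>"
  proof (rule kronecker_sign_targets[OF fin _ _ \<delta>])
    fix l :: "real \<Rightarrow> int"
    assume "cos (\<Sum>\<theta>\<in>?S. of_int (l \<theta>) * arccos \<theta>) = 1"
    then have "even (\<Sum>\<theta>\<in>?M. l \<theta>)" using rel by (simp add: rcong_0_2pi_iff_cos)
    then show "(\<Prod>\<theta>\<in>?S. s \<theta> powi l \<theta>) = 1"
      using prod_sign_powi[OF fin, of ?M l] by (simp add: s_def SM)
  qed (simp add: s_def)
  then obtain n where n: "\<And>\<theta>. \<theta> \<in> ?S \<Longrightarrow> s \<theta> * cos (real n * arccos \<theta>) > 1 - \<delta>"
    by blast
  have close: "\<bar>cos (real n * arccos \<theta>) - s \<theta>\<bar> \<le> \<delta>" if "\<theta> \<in> ?S" for \<theta>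
  proof -
    have "\<bar>c - \<sigma>\<bar> \<le> \<delta>" if "\<sigma> * c > 1 - \<delta>" "\<bar>c\<bar> \<le> 1" "\<sigma> = 1 \<or> \<sigma> = -1" for c \<sigma>
      using that by auto
    then show ?thesis using n[OF that] by (simp add: s_def)
  qed
  \<comment> \<open>On the support the sign sets give the relation. Off the support of
    \<open>a\<close>, strong cospectrality makes the component of \<open>b\<close> vanish as
    well.\<close>
  have b_eq: "\<gamma> *s (E \<theta> *v axis b 1) = s \<theta> *\<^sub>R u \<theta>" if \<theta>: "\<theta> \<in> eigenvalues H" for \<theta>
  proof (cases "\<theta> \<in> ?S")
    case True
    then show ?thesis
      using supp by (auto simp: s_def u_def plus_set_def minus_set_def)
  next
    case False
    then have "u \<theta> = 0" using \<theta> by (simp add: eigenvalue_support_def u_def)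
    moreover obtain \<mu> where "cmod \<mu> = 1" "u \<theta> = \<mu> *s (E \<theta> *v axis b 1)"
      using cosp \<theta> by (auto simp: strongly_cospectral_def u_def)
    ultimately have "norm (E \<theta> *v axis b 1) = 0"
      by (metis mult_1 norm_vector_scalar_mult norm_zero)
    then show ?thesis using \<open>u \<theta> = 0\<close> by simp
  qed
  have "\<gamma> *s axis b 1 = \<gamma> *s (\<Sum>\<theta>\<in>eigenvalues H. E \<theta> *v axis b 1)"
    by (simp add: sum_eigenprojections)
  also have "\<dots> = (\<Sum>\<theta>\<in>eigenvalues H. \<gamma> *s (E \<theta> *v axis b 1))"
    by (rule vec.scale_sum_right)
  finally have "chebyshev n (axis a 1) - \<gamma> *s axis b 1 =
      (\<Sum>\<theta>\<in>eigenvalues H. (cos (real n * arccos \<theta>) - s \<theta>) *\<^sub>R u \<theta>)"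
    by (simp add: chebyshev_def b_eq u_def sum_subtractf[symmetric] scaleR_left_diff_distrib
        cong: sum.cong)
  also have "norm \<dots> \<le> (\<Sum>\<theta>\<in>eigenvalues H. \<delta>)"
  proof (rule sum_norm_le)
    fix \<theta> assume \<theta>: "\<theta> \<in> eigenvalues H"
    show "norm ((cos (real n * arccos \<theta>) - s \<theta>) *\<^sub>R u \<theta>) \<le> \<delta>"
    proof (cases "\<theta> \<in> ?S")
      case True
      have "norm (u \<theta>) \<le> 1"
        using norm_eigenprojection_le[of \<theta> "axis a 1"] by (simp add: u_def)
      then have "\<bar>cos (real n * arccos \<theta>) - s \<theta>\<bar> * norm (u \<theta>) \<le> \<delta> * 1"
        using close[OF True] \<delta> by (intro mult_mono) auto
      then show ?thesis by simp
    next
      case False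
      then have "u \<theta> = 0" using \<theta> by (simp add: eigenvalue_support_def u_def)
      then show ?thesis using \<delta> by simp
    qed
  qed
  also have "\<dots> < \<epsilon>" using \<open>\<epsilon> > 0\<close> by (simp add: \<delta>_def field_simps)
  finally show ?thesis by blast
qed

end

section \<open>The arc-reversal walk of a weighted graph\<close>

text \<open>Arc reversal is an involutive permutation of the labels. Rows of the tail matrix for
  different vertices have disjoint supports, and each row is normalised by the norm of the matching
  row of \<open>W\<close>.\<close>

lemma reflection_walk_arc_reversal:
  assumes c: "connected_graph adj" and ar: "arc_labelling adj ar"
    and W: "weighted_adjacency_matrix adj W"
  shows "reflection_walk (tail_matrix ar W) (arc_reversal ar)"
proof
  have sym: "adj u v \<Longrightarrow> adj v u" and irrefl: "\<not> adj u u" for u v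
    using c by (auto simp: connected_graph_def simple_graph_def symp_def irreflp_def)
  have inj: "inj ar" and rng: "range ar = {(u, v). adj u v}"
    using ar by (auto simp: arc_labelling_def bij_betw_def arcs_def)
  have adj_ar: "adj (fst (ar e)) (snd (ar e))" for e
    using rng by (metis (mono_tags, lifting) case_prodD mem_Collect_eq prod.collapse rangeI)
  have "\<exists>f. ar f = prod.swap (ar e)" for e
    using sym[OF adj_ar[of e]] rng
    by (metis (mono_tags, lifting) case_prodI mem_Collect_eq prod.swap_def rangeE)
  then obtain rv where rv: "\<And>e. ar (rv e) = prod.swap (ar e)" by metis
  have swap_iff: "ar e = prod.swap (ar f) \<longleftrightarrow> e = rv f" for e f
    using rv inj by (metis injD)
  have rv_rv: "rv (rv e) = e" for e
    using rv inj by (metis injD swap_swap)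

  show "conj_transpose (arc_reversal ar) = arc_reversal ar"
    by (auto simp: conj_transpose_def arc_reversal_def vec_eq_iff)
  have "(\<Sum>k\<in>UNIV. (if e = rv k then 1 else 0) * (if k = rv f then 1 else 0 :: complex)) =
      (if e = f then 1 else 0)" for e f
  proof -
    have "(if e = rv k then 1 else 0) * (if k = rv f then 1 else 0 :: complex) =
        (if k = rv f then if e = f then 1 else 0 else 0)" for k
      by (auto simp: rv_rv)
    then show ?thesis by (simp only: sum.delta finite) simp
  qed
  then show "arc_reversal ar ** arc_reversal ar = mat 1"
    by (simp add: arc_reversal_def matrix_matrix_mult_def mat_def vec_eq_iff swap_iff)

  have adj_iff: "adj u v \<longleftrightarrow> W $ u $ v \<noteq> 0" for u v
    using W by (simp add: weighted_adjacency_matrix_def)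
  define d where "d u = (\<Sum>v\<in>UNIV. (cmod (W $ u $ v))\<^sup>2)" for u
  have diag: "(W ** conj_transpose W) $ u $ u = of_real (d u)" for u
    by (simp add: matrix_matrix_mult_def conj_transpose_def complex_mult_cnj cmod_power2 d_def)
  have d_nonneg: "d u \<ge> 0" for u by (simp add: d_def sum_nonneg)
  \<comment> \<open>The label type is inhabited, so some arc exists and the graph has at least two
    vertices. Connectedness then gives every vertex a neighbour, and the normalising factor is
    nonzero.\<close>
  have d_pos: "d u > 0" for u
  proof -
    obtain x y where "adj x y" using adj_ar by blast
    with irrefl have "x \<noteq> y" by blast
    then obtain w where "w \<noteq> u" by metis
    have "adj\<^sup>*\<^sup>* u w" using c by (simp add: connected_graph_def)
    then obtain v where "adj u v" using \<open>w \<noteq> u\<close> by (metis converse_rtranclpE)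
    then have "(cmod (W $ u $ v))\<^sup>2 > 0" by (simp add: adj_iff)
    also have "(cmod (W $ u $ v))\<^sup>2 \<le> d u"
      unfolding d_def by (rule member_le_sum) auto
    finally show ?thesis .
  qed
  have N: "tail_matrix ar W $ u $ e =
      (if u = fst (ar e) then W $ u $ snd (ar e) / of_real (sqrt (d u)) else 0)" for u e
    by (auto simp: tail_matrix_def diag csqrt_of_real_nonneg d_nonneg split: prod.split)
  have "(\<Sum>e\<in>UNIV. tail_matrix ar W $ u $ e * cnj (tail_matrix ar W $ v $ e)) =
      (if u = v then 1 else 0)" for u v
  proof (cases "u = v")
    case False
    then show ?thesis by (auto simp: N intro!: sum.neutral)
  next
    case True
    have "(\<Sum>e\<in>UNIV. tail_matrix ar W $ u $ e * cnj (tail_matrix ar W $ u $ e)) =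
        (\<Sum>e\<in>UNIV. if fst (ar e) = u then of_real ((cmod (W $ fst (ar e) $ snd (ar e)))\<^sup>2 / d u) else 0)"
    proof (intro sum.cong refl)
      fix e
      have "z * cnj z = of_real ((cmod w)\<^sup>2 / d u)" if "z = w / of_real (sqrt (d u))" for z w
      proof -
        have "z * cnj z = of_real ((cmod z)\<^sup>2)" by (rule complex_norm_square[symmetric])
        also have "(cmod z)\<^sup>2 = (cmod w)\<^sup>2 / d u"
          by (simp add: that norm_divide power_divide d_nonneg)
        finally show ?thesis .
      qed
      then show "tail_matrix ar W $ u $ e * cnj (tail_matrix ar W $ u $ e) =
          (if fst (ar e) = u then of_real ((cmod (W $ fst (ar e) $ snd (ar e)))\<^sup>2 / d u) else 0)"
        using N[of u e] by (cases "fst (ar e) = u") simp_all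
    qed
    \<comment> \<open>The sum passes from labels to arcs, and then to all vertex pairs because
      weights vanish off the arcs; what remains is the row sum \<open>d u\<close>.\<close>
    also have "\<dots> = (\<Sum>p\<in>arcs adj. if fst p = u then of_real ((cmod (W $ fst p $ snd p))\<^sup>2 / d u) else 0)"
      using ar unfolding arc_labelling_def by (rule sum.reindex_bij_betw)
    also have "\<dots> = (\<Sum>p\<in>UNIV. if fst p = u then of_real ((cmod (W $ fst p $ snd p))\<^sup>2 / d u) else 0)"
      by (intro sum.mono_neutral_left) (auto simp: arcs_def adj_iff)
    also have "\<dots> = (\<Sum>x\<in>UNIV. \<Sum>y\<in>UNIV. if x = u then of_real ((cmod (W $ x $ y))\<^sup>2 / d u) else 0)"
      by (simp add: sum.cartesian_product case_prod_beta UNIV_Times_UNIV)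
    also have "\<dots> = (\<Sum>y\<in>UNIV. of_real ((cmod (W $ u $ y))\<^sup>2 / d u))"
      by (subst sum.swap) simp
    also have "\<dots> = of_real (d u / d u)"
      by (simp only: of_real_sum[symmetric] sum_divide_distrib[symmetric] d_def[symmetric])
    also have "\<dots> = 1" using d_pos[of u] by simp
    finally show ?thesis using True by simp
  qed
  then show "tail_matrix ar W ** conj_transpose (tail_matrix ar W) = mat 1"
    by (simp add: matrix_matrix_mult_def conj_transpose_def mat_def vec_eq_iff)
qed

text \<open>The minus set depends on \<open>\<gamma>\<close>, so the parity condition shares its
  existential quantifier with the support condition. A family indexed by the support is represented
  by a function \<open>l\<close> on the reals, of which only the values on the support
  enter.\<close>

theorem theorem3p6:
  fixes adj :: "'v::finite \<Rightarrow> 'v \<Rightarrow> bool"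
    and ar :: "'e::finite \<Rightarrow> 'v \<times> 'v"
    and W H :: "complex^'v^'v"
    and a b :: 'v
  assumes "connected_graph adj"
    and "arc_labelling adj ar"
    and "weighted_adjacency_matrix adj W"
    and "H = hermitian_adjacency W"
  shows "vertex_pgst ar W a b \<longleftrightarrow>
    strongly_cospectral H a b \<and>
    (\<exists>\<gamma>. cmod \<gamma> = 1 \<and>
       eigenvalue_support H a = plus_set H \<gamma> a b \<union> minus_set H \<gamma> a b \<and>
       (\<forall>l :: real \<Rightarrow> int.
          [(\<Sum>\<theta>\<in>eigenvalue_support H a. of_int (l \<theta>) * arccos \<theta>) = 0] (rmod (2 * pi))
          \<longrightarrow> even (\<Sum>\<theta>\<in>minus_set H \<gamma> a b. l \<theta>)))"
proof -
  interpret walk: reflection_walk "tail_matrix ar W" "arc_reversal ar"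
    using assms(1-3) by (rule reflection_walk_arc_reversal)
  have H: "walk.H = H"
    using hermitian_adjacency_eq_tail_matrix[OF assms(2,3,1)] assms(4) by (simp add: walk.H_def)
  have "vertex_pgst ar W a b \<longleftrightarrow>
      (\<exists>\<gamma>. cmod \<gamma> = 1 \<and>
        (\<forall>\<epsilon>>0. \<exists>n. norm (walk.chebyshev n (axis a 1) - \<gamma> *s axis b 1) < \<epsilon>))"
    using walk.pgst_iff_chebyshev[of "axis a 1" "axis b 1"]
    by (simp add: vertex_pgst_def transition_matrix_def walk.U_def)
  also have "\<dots> \<longleftrightarrow> strongly_cospectral H a b \<and>
    (\<exists>\<gamma>. cmod \<gamma> = 1 \<and>
       eigenvalue_support H a = plus_set H \<gamma> a b \<union> minus_set H \<gamma> a b \<and>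
       (\<forall>l :: real \<Rightarrow> int.
          [(\<Sum>\<theta>\<in>eigenvalue_support H a. of_int (l \<theta>) * arccos \<theta>) = 0] (rmod (2 * pi))
          \<longrightarrow> even (\<Sum>\<theta>\<in>minus_set H \<gamma> a b. l \<theta>)))"
    (is "?P \<longleftrightarrow> ?C")
  proof
    assume ?P
    then obtain \<gamma> where \<gamma>: "cmod \<gamma> = 1"
      "\<forall>\<epsilon>>0. \<exists>n. norm (walk.chebyshev n (axis a 1) - \<gamma> *s axis b 1) < \<epsilon>"
      by blast
    show ?C
      using walk.chebyshev_pgst_necessary[OF \<gamma>] \<gamma>(1) unfolding H by blast
  next
    assume ?C
    then obtain \<gamma> where "cmod \<gamma> = 1"
      and suff: "strongly_cospectral H a b"
        "eigenvalue_support H a = plus_set H \<gamma> a b \<union> minus_set H \<gamma> a b"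
        "\<forall>l. [(\<Sum>\<theta>\<in>eigenvalue_support H a. of_int (l \<theta>) * arccos \<theta>) = 0] (rmod (2 * pi))
          \<longrightarrow> even (\<Sum>\<theta>\<in>minus_set H \<gamma> a b. l \<theta>)"
      by blast
    then show ?P
      using walk.chebyshev_pgst_sufficient[OF suff[folded H]] by blast
  qed
  finally show ?thesis .
qed

end
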